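(* A relational structure $R=(E,(\rho_i)_{i\in I})$ admits a finite monomorphic decomposition if and only if there exist a linear order $\leq$ on $E$ and a finite partition $(E_x)_{x\in X}$ of $E$ into intervals of $(E,\leq)$ such that every local isomorphism of $(E,\leq)$ which preserves each interval $E_x$ is a local isomorphism of $R$. Moreover, in that case there exists such a partition (with such a linear order) whose number of infinite blocks is the monomorphic dimension of $R$.
   Context: A relational structure is a pair $R=(E,(\rho_i)_{i\in I})$ where $E$ is a set and each $\rho_i$ is an $m_i$-ary relation on $E$ ($I$ may be infinite). The restriction of $R$ to $A\subseteq E$ is $R_{\restriction A}=(A,(A^{m_i}\cap\rho_i)_{i\in I})$. A local isomorphism of $R$ is an isomorphism between two restrictions of $R$ (that is, a bijection $f:A\to A'$ with $A,A'\subseteq E$ which is an isomorphism from $R_{\restriction A}$ onto $R_{\restriction A'}$). A local isomorphism $f$ preserves $E_x$ if it maps elements of its domain lying in $E_x$ to elements of $E_x$. A set partition $(E_x)_{x\in X}$ of $E$ is a monomorphic decomposition of $R$ if, for any two finite subsets $A,A'$ of $E$ such that $|A\cap E_x|=|A'\cap E_x|$ for all $x\in X$, the restrictions $R_{\restriction A}$ and $R_{\restriction A'}$ are isomorphic. It is finite if $X$ is finite. There is a (unique) monomorphic decomposition of $R$, called minimal, such that every monomorphic decomposition of $R$ is a refinement of it; the monomorphic dimension of $R$ is the number of infinite blocks of the minimal monomorphic decomposition. *)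

theory Defs
  imports "HOL-Library.Disjoint_Sets" "HOL-Library.NList" "HOL-Library.Extended_Nat"
begin

text \<open>
  The set of \<open>n\<close>-tuples over \<open>A\<close> is \<^term>\<open>nlists n A\<close>; an \<open>n\<close>-ary relation is a subset of it.
  Only the values of the arity and of the relations on the index set \<open>rel_index R\<close> are meaningful;
  the index set and the base set may be infinite.
\<close>

record ('a, 'i) rel_struct =
  base :: "'a set"
  rel_index :: "'i set"
  rel_arity :: "'i \<Rightarrow> nat"
  rel_at :: "'i \<Rightarrow> 'a list set"

definition relational_structure :: "('a, 'i) rel_struct \<Rightarrow> bool" where
  "relational_structure R \<longleftrightarrow>
     (\<forall>i\<in>rel_index R. rel_at R i \<subseteq> nlists (rel_arity R i) (base R))"

definition restriction :: "('a, 'i) rel_struct \<Rightarrow> 'a set \<Rightarrow> ('a, 'i) rel_struct" where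
  "restriction R A =
     \<lparr> base = A,
       rel_index = rel_index R,
       rel_arity = rel_arity R,
       rel_at = (\<lambda>i. nlists (rel_arity R i) A \<inter> rel_at R i) \<rparr>"

definition rel_isomorphism ::
    "('a \<Rightarrow> 'b) \<Rightarrow> ('a, 'i) rel_struct \<Rightarrow> ('b, 'i) rel_struct \<Rightarrow> bool" where
  "rel_isomorphism f R S \<longleftrightarrow>
     rel_index R = rel_index S \<and>
     (\<forall>i\<in>rel_index R. rel_arity R i = rel_arity S i) \<and>
     bij_betw f (base R) (base S) \<and>
     (\<forall>i\<in>rel_index R. \<forall>xs\<in>nlists (rel_arity R i) (base R).
        xs \<in> rel_at R i \<longleftrightarrow> map f xs \<in> rel_at S i)"

definition rel_isomorphic :: "('a, 'i) rel_struct \<Rightarrow> ('b, 'i) rel_struct \<Rightarrow> bool" where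
  "rel_isomorphic R S \<longleftrightarrow> (\<exists>f. rel_isomorphism f R S)"

text \<open>
  A local isomorphism is a partial map, given by a total function \<open>f\<close> together with its domain \<open>A\<close>
  and its codomain \<open>A'\<close>; the values of \<open>f\<close> outside \<open>A\<close> are irrelevant.
\<close>

definition local_isomorphism ::
    "('a, 'i) rel_struct \<Rightarrow> ('a \<Rightarrow> 'a) \<Rightarrow> 'a set \<Rightarrow> 'a set \<Rightarrow> bool" where
  "local_isomorphism R f A A' \<longleftrightarrow>
     A \<subseteq> base R \<and> A' \<subseteq> base R \<and>
     rel_isomorphism f (restriction R A) (restriction R A')"

definition preserves :: "('a \<Rightarrow> 'a) \<Rightarrow> 'a set \<Rightarrow> 'a set \<Rightarrow> bool" where
  "preserves f A B \<longleftrightarrow> f ` (A \<inter> B) \<subseteq> B"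

text \<open>
  Partitions are sets of nonempty blocks (\<^const>\<open>partition_on\<close>), so that an index set for the
  blocks is not needed.
\<close>

definition monomorphic_decomposition :: "('a, 'i) rel_struct \<Rightarrow> 'a set set \<Rightarrow> bool" where
  "monomorphic_decomposition R P \<longleftrightarrow>
     partition_on (base R) P \<and>
     (\<forall>A A'. A \<subseteq> base R \<and> finite A \<and> A' \<subseteq> base R \<and> finite A' \<and>
        (\<forall>B\<in>P. card (A \<inter> B) = card (A' \<inter> B)) \<longrightarrow>
        rel_isomorphic (restriction R A) (restriction R A'))"

definition is_minimal_monomorphic_decomposition ::
    "('a, 'i) rel_struct \<Rightarrow> 'a set set \<Rightarrow> bool" where
  "is_minimal_monomorphic_decomposition R P \<longleftrightarrow>
     monomorphic_decomposition R P \<and>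
     (\<forall>Q. monomorphic_decomposition R Q \<longrightarrow> refines (base R) Q P)"

definition minimal_monomorphic_decomposition :: "('a, 'i) rel_struct \<Rightarrow> 'a set set" where
  "minimal_monomorphic_decomposition R = (THE P. is_minimal_monomorphic_decomposition R P)"

text \<open>The value is \<open>\<infinity>\<close>, rather than the default value of \<^const>\<open>card\<close>, if there are infinitely many.\<close>

definition num_infinite_blocks :: "'a set set \<Rightarrow> enat" where
  "num_infinite_blocks P =
     (if finite {B \<in> P. infinite B} then enat (card {B \<in> P. infinite B}) else \<infinity>)"

definition monomorphic_dimension :: "('a, 'i) rel_struct \<Rightarrow> enat" where
  "monomorphic_dimension R = num_infinite_blocks (minimal_monomorphic_decomposition R)"

text \<open>The ordered set \<open>(E, \<le>)\<close>, with \<open>r\<close> the graph of \<open>\<le>\<close>, as a relational structure.\<close>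

definition order_struct :: "'a set \<Rightarrow> 'a rel \<Rightarrow> ('a, unit) rel_struct" where
  "order_struct E r =
     \<lparr> base = E,
       rel_index = {()},
       rel_arity = (\<lambda>_. 2),
       rel_at = (\<lambda>_. {[x, y] | x y. (x, y) \<in> r}) \<rparr>"

definition order_interval :: "'a set \<Rightarrow> 'a rel \<Rightarrow> 'a set \<Rightarrow> bool" where
  "order_interval E r B \<longleftrightarrow>
     B \<subseteq> E \<and> (\<forall>x\<in>B. \<forall>z\<in>B. \<forall>y\<in>E. (x, y) \<in> r \<and> (y, z) \<in> r \<longrightarrow> y \<in> B)"

definition finite_interval_decomposition ::
    "('a, 'i) rel_struct \<Rightarrow> 'a rel \<Rightarrow> 'a set set \<Rightarrow> bool" where
  "finite_interval_decomposition R r P \<longleftrightarrow>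
     linear_order_on (base R) r \<and>
     partition_on (base R) P \<and> finite P \<and>
     (\<forall>B\<in>P. order_interval (base R) r B) \<and>
     (\<forall>f A A'. local_isomorphism (order_struct (base R) r) f A A' \<and> (\<forall>B\<in>P. preserves f A B) \<longrightarrow>
        local_isomorphism R f A A')"

end

theory Submission
  imports Defs "HOL-Library.Ramsey" "HOL-Analysis.Product_Topology"
begin

text \<open>
  If local isomorphisms of \<open>\<le>\<close> that preserve the intervals are local isomorphisms of \<open>R\<close>, then two
  finite sets with equally many elements in each interval are isomorphic, because the increasing
  bijection between them is such a map.  Here it is decomposed into moves of a single element
  (\<open>finite_interval_decomposition_exchange_less\<close>).

  The converse is a combination of Ramsey's theorem and compactness.  Call two elements exchangeable
  if replacing one by the other in any finite set gives an isomorphic restriction.  This is an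
  equivalence relation, and its classes are the blocks of the minimal decomposition
  (\<open>is_minimal_exchange_classes\<close>).  Colour \<open>E\<close> so that each infinite class is one colour and each
  element of a finite class has its own colour; if there is a finite decomposition, there are
  finitely many colours.  What is needed is a linear order in which the colours are intervals and
  membership of a tuple in a relation depends only on its colours and its order type.  By
  compactness it is enough to find such an order for a finite \<open>F \<subseteq> E\<close> and finitely many relations.

  Ramsey's theorem gives the order not on \<open>F\<close> but on a set \<open>F'\<close> with as many elements of each
  colour as \<open>F\<close> (\<open>homogeneous_copy\<close>).  Since exchange classes form a monomorphic decomposition, there
  is an isomorphism \<open>g\<close> from the restriction to \<open>F\<close> onto the restriction to \<open>F'\<close>, and the order can
  be pulled back along \<open>g\<close>, provided that two elements have the same colour exactly if their
  images under \<open>g\<close> have.  An arbitrary monomorphic decomposition gives no control over \<open>g\<close>, but the minimal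
  one is determined by the isomorphism type of a finite restriction: if \<open>F\<close> is large, elements of
  \<open>F\<close> are exchangeable in \<open>F\<close> only if they are exchangeable in \<open>E\<close>, and then \<open>g\<close> has to permute the
  traces of the classes (\<open>isomorphism_preserves_exchangeability\<close>).  It maps infinite classes to
  infinite classes if \<open>F\<close> contains more elements of each of them than any finite class has.  The
  passage to finitely many relations is what makes the number of Ramsey colours finite, while \<open>g\<close>
  preserves all relations.

  The intervals obtained are the infinite classes and singletons, hence the number of infinite
  intervals is the monomorphic dimension.
\<close>

(* As rewrite rules these have premises with variables that the conclusion does not determine. *)
declare nlistsE_length [simp del] nlistsE_set [simp del]

section \<open>Isomorphic restrictions and exchangeable elements\<close>

abbreviation isomorphic_restrictions :: "('a, 'i) rel_struct \<Rightarrow> 'a set \<Rightarrow> 'a set \<Rightarrow> bool" where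
  "isomorphic_restrictions R A B \<equiv> rel_isomorphic (restriction R A) (restriction R B)"

lemma rel_isomorphism_restriction_iff:
  "rel_isomorphism f (restriction R A) (restriction R B) \<longleftrightarrow>
     bij_betw f A B \<and>
     (\<forall>i\<in>rel_index R. \<forall>xs\<in>nlists (rel_arity R i) A. xs \<in> rel_at R i \<longleftrightarrow> map f xs \<in> rel_at R i)"
proof -
  have "map f xs \<in> nlists n B" if "bij_betw f A B" "xs \<in> nlists n A" for n xs
    using that by (auto simp: nlists_def bij_betw_def)
  then show ?thesis
    unfolding rel_isomorphism_def restriction_def by simp blast
qed

lemma isomorphic_restrictions_refl: "isomorphic_restrictions R A A"
  unfolding rel_isomorphic_def rel_isomorphism_restriction_iff
  by (rule exI[of _ "\<lambda>x. x"]) (auto simp: bij_betw_def)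

lemma isomorphic_restrictions_trans:
  assumes "isomorphic_restrictions R A B" "isomorphic_restrictions R B C"
  shows "isomorphic_restrictions R A C"
proof -
  obtain f g where
    f: "rel_isomorphism f (restriction R A) (restriction R B)" and
    g: "rel_isomorphism g (restriction R B) (restriction R C)"
    using assms unfolding rel_isomorphic_def by blast
  have B: "map f xs \<in> nlists n B" if "xs \<in> nlists n A" for n xs
    using that f by (auto simp: nlists_def rel_isomorphism_restriction_iff bij_betw_def)
  have "rel_isomorphism (g \<circ> f) (restriction R A) (restriction R C)"
    using f g B unfolding rel_isomorphism_restriction_iff
    by (auto intro: bij_betw_trans simp flip: map_map)
  then show ?thesis
    unfolding rel_isomorphic_def by blast
qed

lemma rel_isomorphism_restriction_subset:
  assumes f: "rel_isomorphism f (restriction R A) (restriction R B)" and C: "C \<subseteq> A"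
  shows "rel_isomorphism f (restriction R C) (restriction R (f ` C))"
  unfolding rel_isomorphism_restriction_iff
proof (intro conjI ballI)
  show "bij_betw f C (f ` C)"
    using f C inj_on_subset by (auto simp: rel_isomorphism_restriction_iff bij_betw_def)
  fix i xs
  assume "i \<in> rel_index R" "xs \<in> nlists (rel_arity R i) C"
  then show "xs \<in> rel_at R i \<longleftrightarrow> map f xs \<in> rel_at R i"
    using f nlists_mono[OF C] by (simp add: rel_isomorphism_restriction_iff subset_iff)
qed

lemma rel_isomorphism_restriction_inv:
  assumes "rel_isomorphism f (restriction R A) (restriction R B)"
  shows "rel_isomorphism (inv_into A f) (restriction R B) (restriction R A)"
proof -
  have f: "bij_betw f A B"
    using assms by (simp add: rel_isomorphism_restriction_iff)
  have "xs \<in> rel_at R i \<longleftrightarrow> map (inv_into A f) xs \<in> rel_at R i"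
    if i: "i \<in> rel_index R" and xs: "xs \<in> nlists (rel_arity R i) B" for i xs
  proof -
    have B: "x \<in> B" if "x \<in> set xs" for x
      using xs that by (auto simp: nlists_def)
    have "inv_into A f x \<in> A" if "x \<in> set xs" for x
      using B[OF that] f bij_betw_inv_into[OF f] bij_betwE by fast
    then have "map (inv_into A f) xs \<in> nlists (rel_arity R i) A"
      using xs by (auto simp: nlists_def)
    moreover have "map f (map (inv_into A f) xs) = xs"
      using B f by (simp add: map_idI bij_betw_inv_into_right)
    ultimately show ?thesis
      using assms i unfolding rel_isomorphism_restriction_iff by metis
  qed
  then show ?thesis
    using bij_betw_inv_into[OF f] by (simp add: rel_isomorphism_restriction_iff)
qed

lemma isomorphic_restrictions_sym:
  "isomorphic_restrictions R A B \<Longrightarrow> isomorphic_restrictions R B A"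
  unfolding rel_isomorphic_def by (blast dest: rel_isomorphism_restriction_inv)

text \<open>
  The relation that generates the minimal decomposition.  It is relative to a set \<open>F\<close> because an
  isomorphism between two finite restrictions knows only the exchangeability inside its domain.
\<close>

definition exchangeable :: "('a, 'i) rel_struct \<Rightarrow> 'a set \<Rightarrow> 'a \<Rightarrow> 'a \<Rightarrow> bool" where
  "exchangeable R F a b \<longleftrightarrow>
     a \<in> F \<and> b \<in> F \<and>
     (\<forall>G. finite G \<and> G \<subseteq> F - {a, b} \<longrightarrow> isomorphic_restrictions R (insert a G) (insert b G))"

lemma exchangeableD:
  assumes "exchangeable R F a b" "finite G" "G \<subseteq> F" "a \<notin> G" "b \<notin> G"
  shows "isomorphic_restrictions R (insert a G) (insert b G)"
  using assms unfolding exchangeable_def by blast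

lemma exchangeable_refl: "a \<in> F \<Longrightarrow> exchangeable R F a a"
  by (simp add: exchangeable_def isomorphic_restrictions_refl)

lemma exchangeable_sym: "exchangeable R F a b \<Longrightarrow> exchangeable R F b a"
  unfolding exchangeable_def by (metis insert_commute isomorphic_restrictions_sym)

text \<open>
  If \<open>b\<close> is not one of the other elements, exchange \<open>a\<close> for \<open>b\<close> and \<open>b\<close> for \<open>c\<close>.  If it is, \<open>b\<close>
  changes role: replacing \<open>b\<close> by \<open>c\<close> and then \<open>a\<close> by \<open>b\<close> has the effect of replacing \<open>a\<close> by \<open>c\<close>.
\<close>

lemma exchangeable_trans:
  assumes ab: "exchangeable R F a b" and bc: "exchangeable R F b c"
  shows "exchangeable R F a c"
proof (cases "a = b \<or> b = c \<or> a = c")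
  case True
  with assms show ?thesis
    using exchangeable_refl exchangeable_def by metis
next
  case False
  have F: "a \<in> F" "b \<in> F" "c \<in> F"
    using assms by (auto simp: exchangeable_def)
  have "isomorphic_restrictions R (insert a G) (insert c G)"
    if G: "finite G" "G \<subseteq> F - {a, c}" for G
  proof (cases "b \<in> G")
    case False
    then have "isomorphic_restrictions R (insert a G) (insert b G)"
      "isomorphic_restrictions R (insert b G) (insert c G)"
      using G by (auto intro: exchangeableD[OF ab] exchangeableD[OF bc])
    then show ?thesis
      by (rule isomorphic_restrictions_trans)
  next
    case True
    define H where "H = G - {b}"
    have H: "G = insert b H" "finite H" "H \<subseteq> F - {a, b, c}"
      using G True by (auto simp: H_def)
    have bc': "isomorphic_restrictions R (insert b (insert a H)) (insert c (insert a H))"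
      using H F \<open>\<not> (a = b \<or> b = c \<or> a = c)\<close> by (intro exchangeableD[OF bc]) auto
    have ab': "isomorphic_restrictions R (insert a (insert c H)) (insert b (insert c H))"
      using H F \<open>\<not> (a = b \<or> b = c \<or> a = c)\<close> by (intro exchangeableD[OF ab]) auto
    show ?thesis
      using isomorphic_restrictions_trans[OF bc'[unfolded insert_commute[of c a]] ab']
      by (simp only: H(1) insert_commute)
  qed
  then show ?thesis
    using F by (simp add: exchangeable_def)
qed

text \<open>
  An isomorphism carries the test sets \<open>G\<close> for a pair to the test sets for the image pair.
\<close>

lemma exchangeable_image:
  assumes f: "rel_isomorphism f (restriction R A) (restriction R B)"
    and ab: "exchangeable R A a b"
  shows "exchangeable R B (f a) (f b)"
proof -
  have bij: "bij_betw f A B"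
    using f by (simp add: rel_isomorphism_restriction_iff)
  have mem: "a \<in> A" "b \<in> A"
    using ab by (auto simp: exchangeable_def)
  have "isomorphic_restrictions R (insert (f a) G) (insert (f b) G)"
    if G: "finite G" "G \<subseteq> B - {f a, f b}" for G
  proof -
    define H where "H = inv_into A f ` G"
    have inv: "inv_into A f y \<in> A" "f (inv_into A f y) = y" if "y \<in> G" for y
      using that G(2) bij by (auto simp: bij_betw_def intro: inv_into_into f_inv_into_f)
    have H: "finite H" "H \<subseteq> A - {a, b}" "f ` H = G"
      using G inv by (auto simp: H_def image_iff)
    have im: "isomorphic_restrictions R (insert x H) (insert (f x) G)" if "x \<in> A" for x
      using rel_isomorphism_restriction_subset[OF f, of "insert x H"] H that
      unfolding rel_isomorphic_def by auto
    have "isomorphic_restrictions R (insert a H) (insert b H)"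
      using H by (intro exchangeableD[OF ab]) auto
    then show ?thesis
      using im[OF mem(1)] im[OF mem(2)]
      by (meson isomorphic_restrictions_sym isomorphic_restrictions_trans)
  qed
  then show ?thesis
    using mem bij by (auto simp: exchangeable_def bij_betw_def)
qed

section \<open>Monomorphic decompositions are the partitions into exchangeable elements\<close>

lemma partition_on_block_ex: "partition_on E P \<Longrightarrow> a \<in> E \<Longrightarrow> \<exists>B\<in>P. a \<in> B"
  by (auto simp: partition_on_def)

lemma partition_on_block_unique:
  "partition_on E P \<Longrightarrow> B \<in> P \<Longrightarrow> C \<in> P \<Longrightarrow> a \<in> B \<Longrightarrow> a \<in> C \<Longrightarrow> B = C"
  by (auto simp: partition_on_def disjoint_def)

lemma monomorphic_decomposition_exchangeable:
  assumes P: "monomorphic_decomposition R P" and B: "B \<in> P" "a \<in> B" "b \<in> B"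
  shows "exchangeable R (base R) a b"
proof -
  have part: "partition_on (base R) P"
    using P by (simp add: monomorphic_decomposition_def)
  have E: "a \<in> base R" "b \<in> base R"
    using part B by (auto simp: partition_on_def)
  have "isomorphic_restrictions R (insert a G) (insert b G)"
    if G: "finite G" "G \<subseteq> base R - {a, b}" for G
  proof -
    have "card (insert a G \<inter> C) = card (insert b G \<inter> C)" if "C \<in> P" for C
    proof -
      have "a \<in> C \<longleftrightarrow> b \<in> C"
        using part B that by (auto simp: partition_on_def disjoint_def)
      moreover have "a \<notin> G" "b \<notin> G"
        using G by auto
      ultimately show ?thesis
        using G(1) by (simp add: Int_insert_left)
    qed
    moreover have "insert a G \<subseteq> base R" "insert b G \<subseteq> base R"
      using E G by auto
    ultimately show ?thesis
      using P G(1) by (simp add: monomorphic_decomposition_def)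
  qed
  then show ?thesis
    using E by (simp add: exchangeable_def)
qed

text \<open>
  Conversely, two finite sets with the same number of elements in each block are linked by a chain
  of exchanges inside the blocks, each of which brings the first set closer to the second.
\<close>

lemma monomorphic_decompositionI_exchangeable:
  assumes part: "partition_on (base R) P"
    and ex: "\<And>B a b. B \<in> P \<Longrightarrow> a \<in> B \<Longrightarrow> b \<in> B \<Longrightarrow> exchangeable R (base R) a b"
  shows "monomorphic_decomposition R P"
proof -
  have "isomorphic_restrictions R A A'"
    if "A \<subseteq> base R" "finite A" and A': "A' \<subseteq> base R" "finite A'"
      and "\<And>B. B \<in> P \<Longrightarrow> card (A \<inter> B) = card (A' \<inter> B)" for A A'
    using that(1,2,5)
  proof (induction "card (A - A')" arbitrary: A rule: less_induct)
    case less
    note counts = less.prems(3)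
    show ?case
    proof (cases "A \<subseteq> A'")
      case True
      have "A' \<subseteq> A"
      proof
        fix z assume z: "z \<in> A'"
        then obtain B where B: "B \<in> P" "z \<in> B"
          using A'(1) partition_on_block_ex[OF part] by blast
        have "A \<inter> B = A' \<inter> B"
          using True A'(2) counts[OF B(1)] by (intro card_subset_eq) auto
        then show "z \<in> A"
          using z B(2) by blast
      qed
      with True have "A = A'"
        by (rule equalityI)
      then show ?thesis
        by (simp add: isomorphic_restrictions_refl)
    next
      case False
      then obtain x where x: "x \<in> A" "x \<notin> A'"
        by blast
      then obtain B where B: "B \<in> P" "x \<in> B"
        using less.prems(1) partition_on_block_ex[OF part] by blast
      have "\<not> A' \<inter> B \<subseteq> A \<inter> B"
      proof
        assume "A' \<inter> B \<subseteq> A \<inter> B"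
        then have "A' \<inter> B \<subset> A \<inter> B"
          using x B by blast
        then show False
          using psubset_card_mono[of "A \<inter> B" "A' \<inter> B"] less.prems(2) counts[OF B(1)] by simp
      qed
      then obtain y where y: "y \<in> A'" "y \<in> B" "y \<notin> A"
        by blast
      define A1 where "A1 = insert y (A - {x})"
      have "isomorphic_restrictions R (insert x (A - {x})) A1"
        unfolding A1_def using less.prems(1,2) x y by (intro exchangeableD[OF ex[OF B y(2)]]) auto
      then have first: "isomorphic_restrictions R A A1"
        using x by (simp add: insert_absorb)
      have "A1 - A' = (A - A') - {x}"
        using x y by (auto simp: A1_def)
      moreover have "card ((A - A') - {x}) < card (A - A')"
        using x less.prems(2) by (intro card_Diff1_less) auto
      ultimately have "card (A1 - A') < card (A - A')"
        by simp
      moreover have "A1 \<subseteq> base R" "finite A1"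
        using less.prems(1,2) y A' by (auto simp: A1_def)
      moreover have "card (A1 \<inter> C) = card (A' \<inter> C)" if C: "C \<in> P" for C
      proof (cases "C = B")
        case True
        have "A1 \<inter> B = insert y (A \<inter> B - {x})"
          using y by (auto simp: A1_def)
        then have "card (A1 \<inter> B) = Suc (card (A \<inter> B - {x}))"
          using less.prems(2) y by simp
        also have "\<dots> = card (A \<inter> B)"
          using less.prems(2) x B by (intro card_Suc_Diff1) auto
        finally show ?thesis
          using True counts[OF B(1)] by simp
      next
        case False
        then have "x \<notin> C" "y \<notin> C"
          using partition_on_block_unique[OF part B(1) C] B(2) y(2) by blast+
        then have "A1 \<inter> C = A \<inter> C"
          by (auto simp: A1_def)
        then show ?thesis
          using counts[OF C] by simp
      qed
      ultimately have "isomorphic_restrictions R A1 A'"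
        by (rule less.hyps)
      with first show ?thesis
        by (rule isomorphic_restrictions_trans)
    qed
  qed
  then show ?thesis
    using part by (simp add: monomorphic_decomposition_def)
qed

definition exchange_classes :: "('a, 'i) rel_struct \<Rightarrow> 'a set set" where
  "exchange_classes R = base R // {(a, b). exchangeable R (base R) a b}"

lemma equiv_exchangeable: "equiv (base R) {(a, b). exchangeable R (base R) a b}"
proof (rule equivI)
  show "{(a, b). exchangeable R (base R) a b} \<subseteq> base R \<times> base R"
    by (auto simp: exchangeable_def)
  show "refl_on (base R) {(a, b). exchangeable R (base R) a b}"
    by (rule refl_onI) (simp add: exchangeable_refl)
  show "sym {(a, b). exchangeable R (base R) a b}"
    by (rule symI) (simp, rule exchangeable_sym)
  show "trans {(a, b). exchangeable R (base R) a b}"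
    by (rule transI) (simp, rule exchangeable_trans)
qed

lemma exchangeable_iff_same_class:
  assumes "B \<in> exchange_classes R" "a \<in> B"
  shows "exchangeable R (base R) a b \<longleftrightarrow> b \<in> B"
proof -
  obtain x where x: "B = {(a, b). exchangeable R (base R) a b} `` {x}"
    using assms(1) unfolding exchange_classes_def by (rule quotientE)
  then have xa: "exchangeable R (base R) x a"
    using assms(2) by simp
  have "exchangeable R (base R) a b \<longleftrightarrow> exchangeable R (base R) x b"
    using exchangeable_trans[OF xa, of b] exchangeable_trans[OF exchangeable_sym[OF xa], of b]
    by blast
  then show ?thesis
    by (simp add: x)
qed

lemma is_minimal_exchange_classes: "is_minimal_monomorphic_decomposition R (exchange_classes R)"
proof -
  have part: "partition_on (base R) (exchange_classes R)"
    unfolding exchange_classes_def by (rule partition_on_quotient[OF equiv_exchangeable])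
  have "refines (base R) Q (exchange_classes R)" if Q: "monomorphic_decomposition R Q" for Q
  proof -
    have "\<exists>C\<in>exchange_classes R. B \<subseteq> C" if B: "B \<in> Q" for B
    proof -
      have partQ: "partition_on (base R) Q"
        using Q by (simp add: monomorphic_decomposition_def)
      then have "B \<noteq> {}"
        using B partition_onD3 by blast
      then obtain a where a: "a \<in> B"
        by blast
      have "a \<in> base R"
        using partition_onD1[OF partQ] B a by auto
      then obtain C where C: "C \<in> exchange_classes R" "a \<in> C"
        using partition_on_block_ex[OF part, of a] by auto
      have "B \<subseteq> C"
        using monomorphic_decomposition_exchangeable[OF Q B a] exchangeable_iff_same_class[OF C]
        by auto
      with C show ?thesis
        by blast
    qed
    then show ?thesis
      using Q part by (simp add: refines_def monomorphic_decomposition_def)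
  qed
  moreover have "monomorphic_decomposition R (exchange_classes R)"
    by (rule monomorphic_decompositionI_exchangeable[OF part])
      (rule exchangeable_iff_same_class[THEN iffD2])
  ultimately show ?thesis
    unfolding is_minimal_monomorphic_decomposition_def by blast
qed

lemma minimal_monomorphic_decomposition_eq: "minimal_monomorphic_decomposition R = exchange_classes R"
  unfolding minimal_monomorphic_decomposition_def
proof (rule the_equality)
  show "P = exchange_classes R" if "is_minimal_monomorphic_decomposition R P" for P
  proof (rule refines_asym)
    note P = that[unfolded is_minimal_monomorphic_decomposition_def]
    note X = is_minimal_exchange_classes[of R, unfolded is_minimal_monomorphic_decomposition_def]
    show "refines (base R) P (exchange_classes R)"
      using X[THEN conjunct2] P[THEN conjunct1] by blast
    show "refines (base R) (exchange_classes R) P"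
      using P[THEN conjunct2] X[THEN conjunct1] by blast
  qed
qed (rule is_minimal_exchange_classes)

lemma finite_exchange_classes:
  assumes P: "monomorphic_decomposition R P" and "finite P"
  shows "finite (exchange_classes R)"
proof -
  have ref: "refines (base R) P (exchange_classes R)"
    using is_minimal_exchange_classes[of R] P
    by (simp add: is_minimal_monomorphic_decomposition_def)
  have "exchange_classes R \<subseteq> Union ` Pow P"
  proof
    fix q assume "q \<in> exchange_classes R"
    then have "partition_on q {p \<in> P. p \<subseteq> q}"
      by (rule refines_obtains_subset[OF ref])
    then have "q = \<Union>{p \<in> P. p \<subseteq> q}"
      by (rule partition_onD1)
    then show "q \<in> Union ` Pow P"
      by blast
  qed
  then show ?thesis
    using \<open>finite P\<close> by (meson finite_Pow_iff finite_imageI finite_subset)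
qed

section \<open>Interval decompositions are monomorphic\<close>

lemma local_isomorphism_order_struct_iff:
  "local_isomorphism (order_struct E r) f A A' \<longleftrightarrow>
     A \<subseteq> E \<and> A' \<subseteq> E \<and> bij_betw f A A' \<and> (\<forall>x\<in>A. \<forall>y\<in>A. (x, y) \<in> r \<longleftrightarrow> (f x, f y) \<in> r)"
proof -
  have pairs: "(\<forall>xs\<in>nlists 2 A. Q xs) \<longleftrightarrow> (\<forall>x\<in>A. \<forall>y\<in>A. Q [x, y])" for Q
    by (auto simp: nlists_def numeral_2_eq_2 length_Suc_conv)
  show ?thesis
    unfolding local_isomorphism_def rel_isomorphism_restriction_iff
    by (simp add: order_struct_def pairs)
qed

text \<open>
  Moving one element of a block past no other element of the set is a local isomorphism of the
  order that preserves the intervals.  A longer move is a composition of shorter ones: with \<open>z\<close>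
  between \<open>x\<close> and \<open>y\<close>, first \<open>z\<close> moves to \<open>y\<close> and then \<open>x\<close> moves to \<open>z\<close>.
\<close>

lemma finite_interval_decomposition_exchange_less:
  assumes D: "finite_interval_decomposition R r P"
    and B: "B \<in> P" "x \<in> B" "y \<in> B" "(x, y) \<in> r" "x \<noteq> y"
    and G: "finite G" "G \<subseteq> base R - {x, y}"
  shows "isomorphic_restrictions R (insert x G) (insert y G)"
  using B(2-) G
proof (induction "card {z \<in> G. (x, z) \<in> r \<and> (z, y) \<in> r}" arbitrary: x y G rule: less_induct)
  case less
  have lin: "linear_order_on (base R) r" and part: "partition_on (base R) P"
    and int: "order_interval (base R) r B"
    using D B(1) by (auto simp: finite_interval_decomposition_def)
  have r: "refl_on (base R) r" "trans r" "antisym r" "total_on (base R) r"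
    using lin by (auto simp: order_on_defs)
  have BE: "B \<subseteq> base R"
    using int by (simp add: order_interval_def)
  show ?case
  proof (cases "\<exists>z\<in>G. (x, z) \<in> r \<and> (z, y) \<in> r")
    case False
    define f where "f z = (if z = x then y else z)" for z
    have above: "(x, z) \<in> r \<longleftrightarrow> (y, z) \<in> r" if z: "z \<in> G" for z
    proof
      assume xz: "(x, z) \<in> r"
      then have "(z, y) \<notin> r"
        using False z by blast
      then show "(y, z) \<in> r"
        using r(4) less.prems BE z unfolding total_on_def by blast
    next
      assume "(y, z) \<in> r"
      then show "(x, z) \<in> r"
        using r(2) less.prems(3) by (meson transD)
    qed
    have below: "(z, x) \<in> r \<longleftrightarrow> (z, y) \<in> r" if z: "z \<in> G" for z
    proof
      assume "(z, x) \<in> r"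
      then show "(z, y) \<in> r"
        using r(2) less.prems(3) by (meson transD)
    next
      assume zy: "(z, y) \<in> r"
      then have "(x, z) \<notin> r"
        using False z by blast
      then show "(z, x) \<in> r"
        using r(4) less.prems BE z unfolding total_on_def by blast
    qed
    have refl: "(x, x) \<in> r" "(y, y) \<in> r"
      using r(1) less.prems BE by (auto simp: refl_on_def)
    have "bij_betw f (insert x G) (insert y G)"
      using less.prems by (auto simp: bij_betw_def inj_on_def f_def)
    moreover have "\<forall>p\<in>insert x G. \<forall>q\<in>insert x G. (p, q) \<in> r \<longleftrightarrow> (f p, f q) \<in> r"
      using above below refl less.prems(6) by (auto simp: f_def)
    moreover have "insert x G \<subseteq> base R" "insert y G \<subseteq> base R"
      using less.prems BE by auto
    ultimately have "local_isomorphism (order_struct (base R) r) f (insert x G) (insert y G)"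
      by (simp add: local_isomorphism_order_struct_iff)
    moreover have "preserves f (insert x G) C" if C: "C \<in> P" for C
    proof -
      have "x \<in> C \<longrightarrow> y \<in> C"
        using partition_on_block_unique[OF part B(1) C] less.prems by blast
      then show ?thesis
        by (auto simp: preserves_def f_def)
    qed
    ultimately have "local_isomorphism R f (insert x G) (insert y G)"
      using D unfolding finite_interval_decomposition_def by blast
    then show ?thesis
      unfolding local_isomorphism_def rel_isomorphic_def by blast
  next
    case True
    then obtain z where z: "z \<in> G" "(x, z) \<in> r" "(z, y) \<in> r"
      by blast
    have zB: "z \<in> B"
      using int z less.prems unfolding order_interval_def by blast
    define H where "H = G - {z}"
    have H: "G = insert z H" "z \<notin> H" "finite H" "H \<subseteq> base R - {x, y, z}"
      using z less.prems by (auto simp: H_def)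
    have neq: "z \<noteq> x" "z \<noteq> y"
      using z less.prems by auto
    let ?between = "{w \<in> G. (x, w) \<in> r \<and> (w, y) \<in> r}"
    have "{w \<in> insert x H. (z, w) \<in> r \<and> (w, y) \<in> r} \<subset> ?between"
    proof -
      have "(z, x) \<notin> r"
        using r(3) z neq by (meson antisymD)
      then have "{w \<in> insert x H. (z, w) \<in> r \<and> (w, y) \<in> r} \<subseteq> ?between - {z}"
        using H z r(2) by (auto dest: transD)
      then show ?thesis
        using z by blast
    qed
    then have "card {w \<in> insert x H. (z, w) \<in> r \<and> (w, y) \<in> r} < card ?between"
      using less.prems(5) by (intro psubset_card_mono) auto
    then have 1: "isomorphic_restrictions R (insert z (insert x H)) (insert y (insert x H))"
      using H BE less.prems z zB neq by (intro less.hyps) auto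
    have "{w \<in> insert y H. (x, w) \<in> r \<and> (w, z) \<in> r} \<subset> ?between"
    proof -
      have "(y, z) \<notin> r"
        using r(3) z neq by (meson antisymD)
      then have "{w \<in> insert y H. (x, w) \<in> r \<and> (w, z) \<in> r} \<subseteq> ?between - {z}"
        using H z r(2) by (auto dest: transD)
      then show ?thesis
        using z by blast
    qed
    then have "card {w \<in> insert y H. (x, w) \<in> r \<and> (w, z) \<in> r} < card ?between"
      using less.prems(5) by (intro psubset_card_mono) auto
    then have 2: "isomorphic_restrictions R (insert x (insert y H)) (insert z (insert y H))"
      using H BE less.prems z zB neq by (intro less.hyps) auto
    show ?thesis
      using isomorphic_restrictions_trans[OF 1[unfolded insert_commute[of y x]] 2]
      by (simp only: H(1) insert_commute)
  qed
qed

lemma finite_interval_decomposition_imp_monomorphic: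
  assumes D: "finite_interval_decomposition R r P"
  shows "monomorphic_decomposition R P"
proof (rule monomorphic_decompositionI_exchangeable)
  show part: "partition_on (base R) P"
    using D by (simp add: finite_interval_decomposition_def)
  fix B a b
  assume B: "B \<in> P" "a \<in> B" "b \<in> B"
  then have E: "a \<in> base R" "b \<in> base R"
    using part by (auto simp: partition_on_def)
  have total: "total_on (base R) r"
    using D by (simp add: finite_interval_decomposition_def order_on_defs)
  show "exchangeable R (base R) a b"
  proof (cases "a = b")
    case True
    with E show ?thesis
      by (simp add: exchangeable_refl)
  next
    case False
    then consider "(a, b) \<in> r" | "(b, a) \<in> r"
      using total E by (auto simp: total_on_def)
    then show ?thesis
    proof cases
      case 1
      then show ?thesis
        using finite_interval_decomposition_exchange_less[OF D B(1)] B E False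
        by (simp add: exchangeable_def)
    next
      case 2
      then have "exchangeable R (base R) b a"
        using finite_interval_decomposition_exchange_less[OF D B(1)] B E False
        by (simp add: exchangeable_def)
      then show ?thesis
        by (rule exchangeable_sym)
    qed
  qed
qed

section \<open>Order-indiscernible sets of natural numbers\<close>

lemma Ramsey_finite_family:
  fixes \<C> :: "('a set \<Rightarrow> bool) set"
  assumes "finite \<C>" "infinite Z"
  shows "\<exists>H\<subseteq>Z. infinite H \<and>
    (\<forall>C\<in>\<C>. \<forall>S T. S \<subseteq> H \<and> finite S \<and> card S = n \<and> T \<subseteq> H \<and> finite T \<and> card T = n \<longrightarrow> C S = C T)"
  using assms
proof (induction \<C> arbitrary: Z rule: finite_induct)
  case empty
  then show ?case by blast
next
  case (insert C \<C>)
  have "\<forall>S. S \<subseteq> Z \<and> finite S \<and> card S = n \<longrightarrow> of_bool (C S) < (2 :: nat)"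
    by simp
  from Ramsey[OF insert.prems this] obtain Y t where Y: "Y \<subseteq> Z" "infinite Y"
    "\<And>S. S \<subseteq> Y \<Longrightarrow> finite S \<Longrightarrow> card S = n \<Longrightarrow> of_bool (C S) = (t :: nat)"
    by metis
  have C: "C S = C T"
    if "S \<subseteq> Y" "finite S" "card S = n" "T \<subseteq> Y" "finite T" "card T = n" for S T
    using Y(3)[of S] Y(3)[of T] that by (metis of_bool_eq_iff)
  from insert.IH[OF Y(2)] obtain H where H: "H \<subseteq> Y" "infinite H"
    "\<forall>C\<in>\<C>. \<forall>S T. S \<subseteq> H \<and> finite S \<and> card S = n \<and> T \<subseteq> H \<and> finite T \<and> card T = n \<longrightarrow> C S = C T"
    by blast
  have "\<forall>S T. S \<subseteq> H \<and> finite S \<and> card S = n \<and> T \<subseteq> H \<and> finite T \<and> card T = n \<longrightarrow> C S = C T"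
  proof (intro allI impI)
    fix S T
    assume ST: "S \<subseteq> H \<and> finite S \<and> card S = n \<and> T \<subseteq> H \<and> finite T \<and> card T = n"
    then have "S \<subseteq> Y" "T \<subseteq> Y"
      using H(1) by auto
    then show "C S = C T"
      using C[of S T] ST by simp
  qed
  then show ?case
    using H Y(1) by (intro exI[of _ H]) auto
qed

text \<open>
  A list over a set \<open>T\<close> of \<open>N\<close> numbers is the increasing enumeration of \<open>T\<close> read along a list \<open>w\<close> of
  positions below \<open>N\<close>.  There are finitely many \<open>w\<close>, hence Ramsey's theorem makes membership in the
  given sets depend on \<open>w\<close> alone.  Lists with fewer than \<open>N\<close> different entries are read off a set
  that is padded with larger numbers, which leaves the positions unchanged.
\<close>

lemma order_indiscernible_naturals:
  fixes \<Q> :: "nat list set set"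
  assumes "finite \<Q>"
  shows "\<exists>H. infinite H \<and>
    (\<forall>Q\<in>\<Q>. \<forall>ts us. set ts \<subseteq> H \<and> set us \<subseteq> H \<and> length ts = length us \<and> length ts \<le> N \<and>
       (\<forall>j<length ts. \<forall>k<length ts. ts ! j < ts ! k \<longleftrightarrow> us ! j < us ! k) \<longrightarrow> (ts \<in> Q \<longleftrightarrow> us \<in> Q))"
proof -
  define W where "W = {w. set w \<subseteq> {..<N} \<and> length w \<le> N}"
  define \<C> where "\<C> = (\<lambda>(Q, w) T. map ((!) (sorted_list_of_set T)) w \<in> Q) ` (\<Q> \<times> W)"
  have "finite W"
    unfolding W_def by (rule finite_lists_length_le) simp
  then have "finite \<C>"
    using assms by (simp add: \<C>_def)
  from Ramsey_finite_family[OF this infinite_UNIV_nat, of N] obtain H :: "nat set" where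
    H: "infinite H" and
    hom: "\<forall>C\<in>\<C>. \<forall>S T. S \<subseteq> H \<and> finite S \<and> card S = N \<and> T \<subseteq> H \<and> finite T \<and> card T = N
       \<longrightarrow> C S = C T"
    by (elim exE conjE) (rule that)
  have "ts \<in> Q \<longleftrightarrow> us \<in> Q"
    if Q: "Q \<in> \<Q>" and ts: "set ts \<subseteq> H" and us: "set us \<subseteq> H"
      and len: "length ts = length us" "length ts \<le> N"
      and pat: "\<And>j k. j < length ts \<Longrightarrow> k < length ts \<Longrightarrow> ts ! j < ts ! k \<longleftrightarrow> us ! j < us ! k"
    for Q ts us
  proof -
    (* The order isomorphism from the entries of ts to those of us. *)
    define g where "g t = us ! (SOME j. j < length ts \<and> ts ! j = t)" for t
    have g: "g (ts ! j) = us ! j" if j: "j < length ts" for j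
    proof -
      define k where "k = (SOME k. k < length ts \<and> ts ! k = ts ! j)"
      have k: "k < length ts \<and> ts ! k = ts ! j"
        unfolding k_def by (rule someI[of _ j]) (use j in simp)
      then have "us ! k = us ! j"
        using pat[of j k] pat[of k j] j by simp
      then show ?thesis
        by (simp add: g_def k_def)
    qed
    define L where "L = sorted_list_of_set (set ts)"
    have L: "set L = set ts" "sorted L" "distinct L" "length L \<le> N"
      using len(2) card_length[of ts] by (auto simp: L_def)
    have mono: "g s < g t" if st: "s \<in> set ts" "t \<in> set ts" "s < t" for s t
    proof -
      obtain j k where "j < length ts" "ts ! j = s" "k < length ts" "ts ! k = t"
        using st by (metis in_set_conv_nth)
      then show ?thesis
        using pat[of j k] g st(3) by auto
    qed
    have "sorted_wrt (<) L"
      using L by (simp add: strict_sorted_iff)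
    then have "sorted_wrt (\<lambda>s t. g s < g t) L"
      by (rule sorted_wrt_mono_rel[rotated]) (use mono L(1) in auto)
    then have sorted_gL: "sorted_wrt (<) (map g L)"
      by (simp add: sorted_wrt_map)
    have set_gL: "set (map g L) = set us"
    proof -
      have "map g ts = us"
        by (rule nth_equalityI) (use len g in auto)
      then show ?thesis
        using L(1) by (metis image_set)
    qed
    (* The padding Y lies above all entries of both lists, so it can serve both. *)
    define m where "m = sum_list ts + sum_list us"
    have m: "t \<le> m" if "t \<in> set ts \<union> set us" for t
      using that member_le_sum_list[of t ts] member_le_sum_list[of t us] by (auto simp: m_def)
    have "infinite (H - {..m})"
      using H by simp
    then obtain Y where Y: "finite Y" "card Y = N - length L" "Y \<subseteq> H - {..m}"
      using infinite_arbitrarily_large by blast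
    define M where "M = sorted_list_of_set Y"
    have M: "set M = Y" "sorted_wrt (<) M" "length M = N - length L"
      using Y by (simp_all add: M_def)
    have pad: "card (set K \<union> Y) = N \<and> sorted_list_of_set (set K \<union> Y) = K @ M"
      if K: "sorted_wrt (<) K" "set K \<subseteq> set ts \<union> set us" "length K = length L" for K
    proof -
      have "s < y" if "s \<in> set K" "y \<in> Y" for s y
        using m[of s] K(2) Y(3) that by fastforce
      then have "sorted_wrt (<) (K @ M)"
        using K(1) M by (simp add: sorted_wrt_append)
      then have KM: "sorted (K @ M)" "distinct (K @ M)"
        by (simp_all only: strict_sorted_iff)
      have "sorted_list_of_set (set (K @ M)) = K @ M"
        using KM by (rule sorted_list_of_set.idem_if_sorted_distinct)
      moreover have "card (set (K @ M)) = N"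
        using distinct_card[OF KM(2)] K(3) M(3) L(4) by simp
      ultimately show ?thesis
        using M(1) by simp
    qed
    have padL: "card (set ts \<union> Y) = N" "sorted_list_of_set (set ts \<union> Y) = L @ M"
      using pad[OF \<open>sorted_wrt (<) L\<close>] L(1) by auto
    have padU: "card (set us \<union> Y) = N" "sorted_list_of_set (set us \<union> Y) = map g L @ M"
      using pad[OF sorted_gL] set_gL by auto
    define w where "w = map (\<lambda>t. SOME p. p < length L \<and> L ! p = t) ts"
    have w: "w ! j < length L \<and> L ! (w ! j) = ts ! j" if j: "j < length ts" for j
    proof -
      have "\<exists>p. p < length L \<and> L ! p = ts ! j"
        using j L(1) by (metis in_set_conv_nth nth_mem)
      from someI_ex[OF this] show ?thesis
        using j by (simp add: w_def)
    qed
    have "length w = length ts"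
      by (simp add: w_def)
    then have "w \<in> W"
      using w L(4) len(2) by (fastforce simp: W_def in_set_conv_nth)
    then have C: "(\<lambda>T. map ((!) (sorted_list_of_set T)) w \<in> Q) \<in> \<C>"
      using Q unfolding \<C>_def by force
    have "map ((!) (L @ M)) w = ts"
      by (rule nth_equalityI) (use w \<open>length w = length ts\<close> in \<open>auto simp: nth_append\<close>)
    moreover have "map ((!) (map g L @ M)) w = us"
      by (rule nth_equalityI) (use w g len \<open>length w = length ts\<close> in \<open>auto simp: nth_append\<close>)
    moreover have "(map ((!) (sorted_list_of_set (set ts \<union> Y))) w \<in> Q) =
        (map ((!) (sorted_list_of_set (set us \<union> Y))) w \<in> Q)"
      using Y ts us padL(1) padU(1) by (intro hom[rule_format, OF C] conjI) auto
    ultimately show ?thesis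
      by (simp add: padL padU)
  qed
  then have "\<forall>Q\<in>\<Q>. \<forall>ts us. set ts \<subseteq> H \<and> set us \<subseteq> H \<and> length ts = length us \<and> length ts \<le> N \<and>
       (\<forall>j<length ts. \<forall>k<length ts. ts ! j < ts ! k \<longleftrightarrow> us ! j < us ! k) \<longrightarrow> (ts \<in> Q \<longleftrightarrow> us \<in> Q)"
    by simp
  then show ?thesis
    using H by (intro exI[of _ H] conjI)
qed

section \<open>Compactness\<close>

text \<open>
  A condition that depends only on finitely many points is a clopen subset of the Cantor cube
  \<open>'b \<Rightarrow> bool\<close>, which is compact by Tychonoff's theorem.
\<close>

lemma finite_support_compactness:
  fixes good :: "'k \<Rightarrow> 'b set \<Rightarrow> bool"
  assumes supp: "\<And>k. k \<in> K \<Longrightarrow>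
      \<exists>D. finite D \<and> (\<forall>S T. S \<inter> D = T \<inter> D \<longrightarrow> good k S \<longrightarrow> good k T)"
    and sat: "\<And>K'. finite K' \<Longrightarrow> K' \<subseteq> K \<Longrightarrow> \<exists>S. \<forall>k\<in>K'. good k S"
  shows "\<exists>S. \<forall>k\<in>K. good k S"
proof -
  let ?X = "product_topology (\<lambda>_. discrete_topology (UNIV :: bool set)) (UNIV :: 'b set)"
  define C where "C k = {f. good k (Collect f)}" for k
  have compact: "compact_space ?X"
    by (simp add: compact_space_product_topology compact_space_discrete_topology)
  have top: "topspace ?X = UNIV"
    by (simp add: PiE_UNIV_domain)
  have closed: "closedin ?X (C k)" if k: "k \<in> K" for k
  proof -
    obtain D where D: "finite D" "\<And>S T. S \<inter> D = T \<inter> D \<Longrightarrow> good k S \<Longrightarrow> good k T"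
      using supp[OF k] by blast
    have "openin ?X (- C k)"
      unfolding openin_product_topology_alt
    proof (intro ballI)
      fix f assume f: "f \<in> - C k"
      (* The cylinder of the functions that agree with f on D. *)
      define U where "U x = (if x \<in> D then {f x} else UNIV)" for x
      have "finite {x \<in> UNIV. U x \<noteq> topspace (discrete_topology UNIV)}"
        by (rule finite_subset[OF _ D(1)]) (auto simp: U_def)
      moreover have "f \<in> Pi\<^sub>E UNIV U"
        by (auto simp: U_def)
      moreover have "Pi\<^sub>E UNIV U \<subseteq> - C k"
      proof
        fix h assume h: "h \<in> Pi\<^sub>E UNIV U"
        have "h x = f x" if "x \<in> D" for x
          using PiE_mem[OF h, of x] that by (simp add: U_def)
        then have "Collect h \<inter> D = Collect f \<inter> D"
          by auto
        then show "h \<in> - C k"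
          using D(2)[of "Collect h" "Collect f"] f by (auto simp: C_def)
      qed
      ultimately show "\<exists>U. finite {i \<in> UNIV. U i \<noteq> topspace (discrete_topology UNIV)} \<and>
          (\<forall>i\<in>UNIV. openin (discrete_topology UNIV) (U i)) \<and> f \<in> Pi\<^sub>E UNIV U \<and> Pi\<^sub>E UNIV U \<subseteq> - C k"
        by (intro exI[of _ U]) simp
    qed
    then show ?thesis
      by (simp add: closedin_def top Compl_eq_Diff_UNIV)
  qed
  have fip: "\<Inter>\<F> \<noteq> {}" if \<F>: "finite \<F>" "\<F> \<subseteq> C ` K" for \<F>
  proof -
    obtain K' where K': "K' \<subseteq> K" "finite K'" "\<F> = C ` K'"
      using finite_subset_image[OF \<F>] by blast
    then obtain S where "\<forall>k\<in>K'. good k S"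
      using sat by blast
    then have "(\<lambda>x. x \<in> S) \<in> \<Inter>\<F>"
      by (simp add: K'(3) C_def)
    then show ?thesis
      by blast
  qed
  have "\<Inter>(C ` K) \<noteq> {}"
    using compact[unfolded compact_space_fip, rule_format, of "C ` K"] closed fip by blast
  then obtain f where "\<forall>k\<in>K. f \<in> C k"
    by blast
  then show ?thesis
    by (intro exI[of _ "Collect f"]) (simp add: C_def)
qed

section \<open>A homogeneous copy of a finite set\<close>

text \<open>
  In each infinite colour class choose a sequence, and in each other class the constant sequence.
  By \<open>order_indiscernible_naturals\<close> there is an infinite set \<open>H\<close> of indices such that two tuples of
  terms with the same colours, whose indices lie in \<open>H\<close> and have the same order type, belong to the
  same relations among those indexed by \<open>J\<close>.  To get an order in
  which the colours are intervals, the elements of colour \<open>s\<close> have their indices in the \<open>s\<close>-th of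
  consecutive segments of length \<open>K\<close> of \<open>H\<close>.
\<close>

lemma homogeneous_copy:
  fixes c :: "'a \<Rightarrow> nat" and m :: "'i \<Rightarrow> nat" and \<rho> :: "'i \<Rightarrow> 'a list set"
  assumes colours: "finite (c ` E)"
    and fibres: "\<forall>a\<in>E. \<forall>b\<in>E. c a = c b \<and> finite {x \<in> E. c x = c a} \<longrightarrow> a = b"
    and F: "F \<subseteq> E" "finite F" and J: "finite J"
  shows "\<exists>F' pos. F' \<subseteq> E \<and> finite F' \<and> (\<forall>s. card {x \<in> F'. c x = s} = card {x \<in> F. c x = s}) \<and>
      inj_on pos F' \<and> (\<forall>x\<in>F'. \<forall>y\<in>F'. c x < c y \<longrightarrow> (pos x :: nat) < pos y) \<and>
      (\<forall>i\<in>J. \<forall>xs\<in>nlists (m i) F'. \<forall>ys\<in>nlists (m i) F'.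
         map c xs = map c ys \<and>
         (\<forall>j<m i. \<forall>k<m i. pos (xs ! j) < pos (xs ! k) \<longleftrightarrow> pos (ys ! j) < pos (ys ! k)) \<longrightarrow>
         (xs \<in> \<rho> i \<longleftrightarrow> ys \<in> \<rho> i))"
proof -
  have "\<exists>h :: nat \<Rightarrow> 'a. range h \<subseteq> {x \<in> E. c x = s} \<and> (infinite {x \<in> E. c x = s} \<longrightarrow> inj h)"
    if s: "s \<in> c ` E" for s
  proof (cases "finite {x \<in> E. c x = s}")
    case True
    obtain a where "a \<in> E" "c a = s"
      using s by blast
    then show ?thesis
      using True by (intro exI[of _ "\<lambda>_. a"]) auto
  next
    case False
    then show ?thesis
      using infinite_countable_subset[OF False] by blast
  qed
  then have "\<forall>s\<in>c ` E. \<exists>h :: nat \<Rightarrow> 'a.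
      range h \<subseteq> {x \<in> E. c x = s} \<and> (infinite {x \<in> E. c x = s} \<longrightarrow> inj h)"
    by (rule ballI)
  from bchoice[OF this] obtain e :: "nat \<Rightarrow> nat \<Rightarrow> 'a" where
    e': "\<forall>s\<in>c ` E. range (e s) \<subseteq> {x \<in> E. c x = s} \<and> (infinite {x \<in> E. c x = s} \<longrightarrow> inj (e s))"
    by (rule exE)
  have e: "e s t \<in> E \<and> c (e s t) = s" if "s \<in> c ` E" for s t
    using bspec[OF e' that] by auto
  have inj_e: "inj (e s)" if "s \<in> c ` E" "infinite {x \<in> E. c x = s}" for s
    using bspec[OF e' that(1)] that(2) by simp
  (* Any common bound of the finitely many arities will do. *)
  define N where "N = (\<Sum>i\<in>J. m i)"
  have N: "m i \<le> N" if "i \<in> J" for i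
    unfolding N_def by (rule member_le_sum) (use that J in auto)
  define \<Q> where "\<Q> = (\<lambda>(i, ss). {ts. map2 e ss ts \<in> \<rho> i}) ` (SIGMA i:J. nlists (m i) (c ` E))"
  have "finite (nlists n (c ` E))" for n
    using finite_lists_length_eq[OF colours, of n] by (simp add: nlists_def conj_commute)
  then have "finite \<Q>"
    using J by (simp add: \<Q>_def)
  from order_indiscernible_naturals[OF this, of N] obtain H where
    H: "infinite H" and
    ind: "\<forall>Q\<in>\<Q>. \<forall>ts us. set ts \<subseteq> H \<and> set us \<subseteq> H \<and> length ts = length us \<and> length ts \<le> N \<and>
       (\<forall>j<length ts. \<forall>k<length ts. ts ! j < ts ! k \<longleftrightarrow> us ! j < us ! k) \<longrightarrow> (ts \<in> Q \<longleftrightarrow> us \<in> Q)"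
    by (elim exE conjE) (rule that)
  define h where "h = enumerate H"
  have h_mono: "h s < h t \<longleftrightarrow> s < t" for s t
    unfolding h_def using strict_mono_enumerate[OF H] by (rule strict_mono_less)
  have h_in: "h t \<in> H" for t
    unfolding h_def using H by (rule enumerate_in_set)
  define n where "n s = card {x \<in> F. c x = s}" for s
  define K where "K = Suc (card F)"
  have nK: "n s < K" for s
    unfolding n_def K_def using F(2) by (simp add: card_mono le_imp_less_Suc)
  (* Q contains the positions that are used, as many in the s-th segment as F has elements of
     colour s; v reads a position as an element. *)
  define Q where "Q = (\<Union>s\<in>c ` E. (\<lambda>u. K * s + u) ` {..<n s})"
  have finQ: "finite Q"
    unfolding Q_def by (rule finite_UN_I[OF colours]) simp
  have divQ: "(K * s + u) div K = s" if "u < n s" for s u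
    using nK[of s] that by (simp add: div_nat_eqI)
  have Q: "q div K \<in> c ` E \<and> q mod K < n (q div K)" if q_in: "q \<in> Q" for q
  proof -
    obtain s u where s: "s \<in> c ` E" and u: "u < n s" and q: "q = K * s + u"
      using q_in unfolding Q_def by blast
    have "u < K"
      using u nK[of s] by simp
    then show ?thesis
      using s u by (simp add: q divQ[OF u])
  qed
  define v where "v q = e (q div K) (h q)" for q
  have v: "v q \<in> E" "c (v q) = q div K" if "q \<in> Q" for q
    using e[of "q div K" "h q"] Q[OF that] by (auto simp: v_def)
  have inj_v: "inj_on v Q"
  proof (rule inj_onI)
    fix p q assume pq: "p \<in> Q" "q \<in> Q" "v p = v q"
    then have s: "p div K = q div K"
      using v(2)[OF pq(1)] v(2)[OF pq(2)] by simp
    show "p = q"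
    proof (cases "finite {x \<in> E. c x = q div K}")
      case True
      have "n (q div K) \<le> 1"
        unfolding n_def
      proof (rule card_le_Suc0_iff_eq[THEN iffD2, folded One_nat_def])
        show "finite {x \<in> F. c x = q div K}"
          using F(2) by simp
        show "\<forall>x\<in>{x \<in> F. c x = q div K}. \<forall>y\<in>{x \<in> F. c x = q div K}. x = y"
        proof (intro ballI)
          fix x y assume "x \<in> {x \<in> F. c x = q div K}" "y \<in> {x \<in> F. c x = q div K}"
          then have "x \<in> E" "y \<in> E" "c x = c y" "finite {z \<in> E. c z = c x}"
            using F(1) True by auto
          then show "x = y"
            using fibres by blast
        qed
      qed
      then have "p mod K = 0" "q mod K = 0"
        using Q[OF pq(1)] Q[OF pq(2)] s by simp_all
      then show ?thesis
        using s by (metis div_mult_mod_eq)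
    next
      case False
      then have "inj (e (q div K))"
        using inj_e Q[OF pq(2)] by blast
      then have "h p = h q"
        using pq(3) by (simp add: v_def s inj_eq)
      then show ?thesis
        using h_mono[of p q] h_mono[of q p] by simp
    qed
  qed
  define F' where "F' = v ` Q"
  define pos where "pos = inv_into Q v"
  have pos: "pos x \<in> Q" "v (pos x) = x" if "x \<in> F'" for x
    using that by (simp_all add: F'_def pos_def inv_into_into f_inv_into_f)
  have c_pos: "c x = pos x div K" if "x \<in> F'" for x
    using v(2)[OF pos(1)[OF that]] pos(2)[OF that] by simp
  have F'E: "F' \<subseteq> E"
    using v(1) by (auto simp: F'_def)
  have card_fibre: "card {x \<in> F'. c x = s} = card {x \<in> F. c x = s}" for s
  proof (cases "s \<in> c ` E")
    case True
    have "{q \<in> Q. q div K = s} = (\<lambda>u. K * s + u) ` {..<n s}"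
      using True divQ by (force simp: Q_def)
    then have card_Q: "card {q \<in> Q. q div K = s} = n s"
      by (simp add: card_image)
    have "{x \<in> F'. c x = s} = v ` {q \<in> Q. q div K = s}"
      using v(2) by (auto simp: F'_def)
    moreover have "inj_on v {q \<in> Q. q div K = s}"
      using inj_v by (rule inj_on_subset) auto
    ultimately show ?thesis
      using card_Q by (simp add: card_image n_def)
  next
    case False
    then have "{x \<in> F'. c x = s} = {}" "{x \<in> F. c x = s} = {}"
      using F(1) F'E by auto
    then show ?thesis
      by (simp only:)
  qed
  have inj_pos: "inj_on pos F'"
    using pos(2) by (metis inj_onI)
  have pos_mono: "pos x < pos y" if "x \<in> F'" "y \<in> F'" "c x < c y" for x y
  proof (rule ccontr)
    assume "\<not> pos x < pos y"
    then have "pos y div K \<le> pos x div K"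
      by (intro div_le_mono) simp
    then show False
      using c_pos that by simp
  qed
  have equiv: "xs \<in> \<rho> i \<longleftrightarrow> ys \<in> \<rho> i"
    if i: "i \<in> J" and xs: "xs \<in> nlists (m i) F'" and ys: "ys \<in> nlists (m i) F'"
      and col: "map c xs = map c ys"
      and pat: "\<forall>j<m i. \<forall>k<m i. pos (xs ! j) < pos (xs ! k) \<longleftrightarrow> pos (ys ! j) < pos (ys ! k)"
    for i xs ys
  proof -
    have read: "map2 e (map c zs) (map (h \<circ> pos) zs) = zs" if zs: "zs \<in> nlists (m i) F'" for zs
    proof (rule nth_equalityI)
      fix j assume "j < length (map2 e (map c zs) (map (h \<circ> pos) zs))"
      then have j: "j < length zs"
        by simp
      then have "zs ! j \<in> F'"
        using zs by (auto simp: nlists_def)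
      then have "e (c (zs ! j)) (h (pos (zs ! j))) = zs ! j"
        using pos(2) c_pos by (simp add: v_def)
      then show "map2 e (map c zs) (map (h \<circ> pos) zs) ! j = zs ! j"
        using j by simp
    qed simp
    have "set (map c xs) \<subseteq> c ` E" "length xs = m i" "length ys = m i"
      using xs ys F'E by (auto simp: nlists_def)
    then have "{ts. map2 e (map c xs) ts \<in> \<rho> i} \<in> \<Q>"
      using i unfolding \<Q>_def nlists_def by force
    then have "map (h \<circ> pos) xs \<in> {ts. map2 e (map c xs) ts \<in> \<rho> i} \<longleftrightarrow>
        map (h \<circ> pos) ys \<in> {ts. map2 e (map c xs) ts \<in> \<rho> i}"
    proof (rule ind[rule_format], intro conjI allI impI)
      show "set (map (h \<circ> pos) xs) \<subseteq> H" "set (map (h \<circ> pos) ys) \<subseteq> H"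
        using h_in by auto
      show "length (map (h \<circ> pos) xs) = length (map (h \<circ> pos) ys)"
        "length (map (h \<circ> pos) xs) \<le> N"
        using \<open>length xs = m i\<close> \<open>length ys = m i\<close> N[OF i] by simp_all
      show "map (h \<circ> pos) xs ! j < map (h \<circ> pos) xs ! k \<longleftrightarrow>
          map (h \<circ> pos) ys ! j < map (h \<circ> pos) ys ! k"
        if "j < length (map (h \<circ> pos) xs)" "k < length (map (h \<circ> pos) xs)" for j k
        using that pat \<open>length xs = m i\<close> \<open>length ys = m i\<close> by (simp add: h_mono)
    qed
    then show ?thesis
      using read[OF xs] read[OF ys] col by simp
  qed
  show ?thesis
  proof (intro exI[of _ F'] exI[of _ pos] conjI ballI allI impI)
    show "finite F'"
      using finQ by (simp add: F'_def)
    show "xs \<in> \<rho> i \<longleftrightarrow> ys \<in> \<rho> i"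
      if "i \<in> J" "xs \<in> nlists (m i) F'" "ys \<in> nlists (m i) F'"
        "map c xs = map c ys \<and>
         (\<forall>j<m i. \<forall>k<m i. pos (xs ! j) < pos (xs ! k) \<longleftrightarrow> pos (ys ! j) < pos (ys ! k))"
      for i xs ys
      using that(4) by (elim conjE) (rule equiv[OF that(1-3)])
  qed (fact F'E card_fibre inj_pos pos_mono)+
qed

section \<open>Finite restrictions that determine the minimal decomposition\<close>

abbreviation exchange_class :: "('a, 'i) rel_struct \<Rightarrow> 'a \<Rightarrow> 'a set" where
  "exchange_class R a \<equiv> {b. exchangeable R (base R) a b}"

lemma exchange_class_eq_iff:
  "a \<in> base R \<Longrightarrow> exchange_class R a = exchange_class R b \<longleftrightarrow> exchangeable R (base R) a b"
  using exchangeable_refl[of a "base R" R] exchangeable_sym[of R "base R"]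
    exchangeable_trans[of R "base R"] by blast

lemma exchange_classes_eq_image: "exchange_classes R = exchange_class R ` base R"
  by (auto simp: exchange_classes_def quotient_def)

lemma exchangeable_subset:
  assumes "exchangeable R E a b" "F \<subseteq> E" "a \<in> F" "b \<in> F"
  shows "exchangeable R F a b"
  using assms unfolding exchangeable_def by (meson Diff_mono subset_refl subset_trans)

text \<open>
  One representative of each class and one test set for each pair of representatives are enough:
  the elements of a class are exchangeable with its representative in every restriction.
\<close>

lemma exchangeability_witnesses:
  assumes fin: "finite (exchange_classes R)"
  shows "\<exists>W\<subseteq>base R. finite W \<and> (\<forall>a\<in>base R. W \<inter> exchange_class R a \<noteq> {}) \<and>
    (\<forall>F a b. W \<subseteq> F \<longrightarrow> F \<subseteq> base R \<longrightarrow> exchangeable R F a b \<longrightarrow> exchangeable R (base R) a b)"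
proof -
  let ?E = "base R"
  let ?P = "exchange_classes R"
  define rep where "rep B = (SOME x. x \<in> B)" for B :: "'a set"
  have rep: "exchangeable R ?E a (rep (exchange_class R a))" if a: "a \<in> ?E" for a
  proof -
    have "a \<in> exchange_class R a"
      using a by (simp add: exchangeable_refl)
    then have "rep (exchange_class R a) \<in> exchange_class R a"
      unfolding rep_def by (rule someI)
    then show ?thesis
      by simp
  qed
  have "\<exists>G. finite G \<and> G \<subseteq> ?E \<and>
      (\<forall>F. G \<subseteq> F \<longrightarrow> exchangeable R F (rep (fst p)) (rep (snd p)) \<longrightarrow>
        exchangeable R ?E (rep (fst p)) (rep (snd p)))"
    if p: "p \<in> ?P \<times> ?P" for p
  proof (cases "exchangeable R ?E (rep (fst p)) (rep (snd p))")
    case True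
    then show ?thesis
      by (intro exI[of _ "{}"]) simp
  next
    case False
    have mem: "rep B \<in> ?E" if B: "B \<in> ?P" for B
    proof -
      obtain a where "a \<in> ?E" "B = exchange_class R a"
        using B unfolding exchange_classes_eq_image by (rule imageE)
      then show ?thesis
        using rep[of a] by (simp add: exchangeable_def)
    qed
    have "rep (fst p) \<in> ?E" "rep (snd p) \<in> ?E"
      using p mem by auto
    with False have "\<not> (\<forall>G. finite G \<and> G \<subseteq> ?E - {rep (fst p), rep (snd p)} \<longrightarrow>
        isomorphic_restrictions R (insert (rep (fst p)) G) (insert (rep (snd p)) G))"
      by (simp add: exchangeable_def)
    then obtain G where G: "finite G" "G \<subseteq> ?E - {rep (fst p), rep (snd p)}"
      "\<not> isomorphic_restrictions R (insert (rep (fst p)) G) (insert (rep (snd p)) G)"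
      by (simp only: not_all not_imp) (elim exE conjE)
    have "\<not> exchangeable R F (rep (fst p)) (rep (snd p))" if "G \<subseteq> F" for F
      using exchangeableD[of R F "rep (fst p)" "rep (snd p)" G] G that by auto
    then show ?thesis
      using G by (intro exI[of _ G]) auto
  qed
  then have "\<forall>p\<in>?P \<times> ?P. \<exists>G. finite G \<and> G \<subseteq> ?E \<and>
      (\<forall>F. G \<subseteq> F \<longrightarrow> exchangeable R F (rep (fst p)) (rep (snd p)) \<longrightarrow>
        exchangeable R ?E (rep (fst p)) (rep (snd p)))"
    by (rule ballI)
  from bchoice[OF this] obtain wit where
    wit: "\<forall>p\<in>?P \<times> ?P. finite (wit p) \<and> wit p \<subseteq> ?E \<and>
      (\<forall>F. wit p \<subseteq> F \<longrightarrow> exchangeable R F (rep (fst p)) (rep (snd p)) \<longrightarrow>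
        exchangeable R ?E (rep (fst p)) (rep (snd p)))"
    by (rule exE)
  define W where "W = rep ` ?P \<union> (\<Union>p\<in>?P \<times> ?P. wit p)"
  have repW: "rep (exchange_class R a) \<in> W" if "a \<in> ?E" for a
    using that by (auto simp: W_def exchange_classes_eq_image)
  have "finite W"
    unfolding W_def using fin wit by (intro finite_UnI finite_imageI finite_UN_I finite_cartesian_product) auto
  moreover have "W \<subseteq> ?E"
  proof -
    have "rep B \<in> ?E" if "B \<in> ?P" for B
      using that rep by (auto simp: exchange_classes_eq_image exchangeable_def)
    then show ?thesis
      using wit by (auto simp: W_def)
  qed
  moreover have "W \<inter> exchange_class R a \<noteq> {}" if "a \<in> ?E" for a
    using repW[OF that] rep[OF that] by blast
  moreover have "exchangeable R ?E a b"
    if F: "W \<subseteq> F" "F \<subseteq> ?E" and ab: "exchangeable R F a b" for F a b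
  proof -
    have mem: "a \<in> F" "b \<in> F" "a \<in> ?E" "b \<in> ?E"
      using ab F(2) by (auto simp: exchangeable_def)
    let ?a = "rep (exchange_class R a)" and ?b = "rep (exchange_class R b)"
    have a: "exchangeable R ?E a ?a" and b: "exchangeable R ?E b ?b"
      using rep mem by auto
    have "?a \<in> F" "?b \<in> F"
      using repW mem F(1) by auto
    then have "exchangeable R F ?a a" "exchangeable R F b ?b"
      using exchangeable_subset[OF a F(2)] exchangeable_subset[OF b F(2)] mem
      by (auto intro: exchangeable_sym)
    then have F_ab: "exchangeable R F ?a ?b"
      using ab by (blast intro: exchangeable_trans)
    have p: "(exchange_class R a, exchange_class R b) \<in> ?P \<times> ?P"
      using mem by (auto simp: exchange_classes_eq_image)
    then have "wit (exchange_class R a, exchange_class R b) \<subseteq> F"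
      using F(1) unfolding W_def by blast
    then have "exchangeable R ?E ?a ?b"
      using bspec[OF wit p] F_ab by simp
    then have "exchangeable R ?E a ?b"
      by (rule exchangeable_trans[OF a])
    then show ?thesis
      using exchangeable_sym[OF b] by (rule exchangeable_trans)
  qed
  ultimately show ?thesis
    by (intro exI[of _ W] conjI ballI allI impI)
qed

text \<open>
  By \<open>le\<close>, \<open>f'\<close> factors through \<open>f\<close>.  The factor maps the finite set \<open>f ` A\<close> onto itself, so it is
  injective.
\<close>

lemma kernel_eq_if_kernel_le:
  assumes "finite (f ` A)" "f' ` A = f ` A"
    and le: "\<And>x y. x \<in> A \<Longrightarrow> y \<in> A \<Longrightarrow> f x = f y \<Longrightarrow> f' x = f' y"
    and xy: "x \<in> A" "y \<in> A" "f' x = f' y"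
  shows "f x = f y"
proof -
  define \<phi> where "\<phi> = f' \<circ> inv_into A f"
  have \<phi>: "\<phi> (f z) = f' z" if "z \<in> A" for z
    using that le[of "inv_into A f (f z)" z] by (simp add: \<phi>_def inv_into_into f_inv_into_f)
  then have "(\<lambda>z. \<phi> (f z)) ` A = f' ` A"
    by (rule image_cong[OF refl])
  then have "\<phi> ` (f ` A) = f ` A"
    using assms(2) by (simp add: image_image)
  then have "inj_on \<phi> (f ` A)"
    using assms(1) by (intro eq_card_imp_inj_on) simp_all
  moreover have "\<phi> (f x) = \<phi> (f y)"
    using \<phi> xy by simp
  ultimately show ?thesis
    using xy(1,2) by (simp add: inj_on_eq_iff)
qed

text \<open>
  Elements exchangeable in \<open>R\<close> stay exchangeable in \<open>F'\<close>, so their preimages are exchangeable in \<open>F\<close>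
  and, by \<open>recog\<close>, in \<open>R\<close>.  Thus \<open>g\<close> pulls the partition of \<open>F'\<close> into traces of exchange classes
  back to a refinement of that of \<open>F\<close>.  Both have as many blocks as there are classes, hence they
  are equal.
\<close>

lemma isomorphism_preserves_exchangeability:
  assumes fin: "finite (exchange_classes R)"
    and F: "F \<subseteq> base R" and F': "F' \<subseteq> base R"
    and g: "rel_isomorphism g (restriction R F) (restriction R F')"
    and recog: "\<And>a b. exchangeable R F a b \<Longrightarrow> exchangeable R (base R) a b"
    and meet: "\<And>a. a \<in> base R \<Longrightarrow> F \<inter> exchange_class R a \<noteq> {}"
    and meet': "\<And>a. a \<in> base R \<Longrightarrow> F' \<inter> exchange_class R a \<noteq> {}"
    and ab: "a \<in> F" "b \<in> F"
  shows "exchangeable R (base R) (g a) (g b) \<longleftrightarrow> exchangeable R (base R) a b"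
proof -
  let ?E = "base R"
  have bij: "bij_betw g F F'"
    using g by (simp add: rel_isomorphism_restriction_iff)
  have gF: "g x \<in> F'" if "x \<in> F" for x
    using bij that by (rule bij_betwE[THEN bspec])
  have onto: "exchange_class R ` A = exchange_classes R"
    if A: "A \<subseteq> ?E" and A_meet: "\<And>a. a \<in> ?E \<Longrightarrow> A \<inter> exchange_class R a \<noteq> {}" for A
  proof
    show "exchange_class R ` A \<subseteq> exchange_classes R"
      using A by (auto simp: exchange_classes_eq_image)
    show "exchange_classes R \<subseteq> exchange_class R ` A"
    proof
      fix B assume "B \<in> exchange_classes R"
      then obtain a where a: "a \<in> ?E" "B = exchange_class R a"
        by (auto simp: exchange_classes_eq_image)
      then obtain x where "x \<in> A" "exchangeable R ?E a x"
        using A_meet[OF a(1)] by blast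
      then show "B \<in> exchange_class R ` A"
        using exchange_class_eq_iff[OF a(1), of x] a(2) by blast
    qed
  qed
  have img: "exchange_class R ` F = exchange_classes R"
    by (rule onto[OF F meet])
  have img': "(\<lambda>x. exchange_class R (g x)) ` F = exchange_classes R"
    using onto[OF F' meet'] by (simp only: bij_betw_imp_surj_on[OF bij, symmetric] image_image)
  have reflects: "exchangeable R ?E x y" if xy: "x \<in> F" "y \<in> F" "exchangeable R ?E (g x) (g y)" for x y
  proof -
    have "exchangeable R F' (g x) (g y)"
      using exchangeable_subset[OF xy(3) F'] gF xy by blast
    then have "exchangeable R F (inv_into F g (g x)) (inv_into F g (g y))"
      by (rule exchangeable_image[OF rel_isomorphism_restriction_inv[OF g]])
    then show ?thesis
      using bij_betw_inv_into_left[OF bij] xy by (simp add: recog)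
  qed
  have E: "x \<in> ?E" "g x \<in> ?E" if "x \<in> F" for x
    using that gF F F' by auto
  have le: "exchange_class R x = exchange_class R y"
    if "x \<in> F" "y \<in> F" "exchange_class R (g x) = exchange_class R (g y)" for x y
    using that reflects exchange_class_eq_iff E by metis
  show ?thesis
  proof
    show "exchangeable R ?E a b" if "exchangeable R ?E (g a) (g b)"
      using that by (rule reflects[OF ab])
    assume "exchangeable R ?E a b"
    then have class_ab: "exchange_class R a = exchange_class R b"
      by (simp only: exchange_class_eq_iff[OF E(1)[OF ab(1)]])
    have fin_img: "finite ((\<lambda>x. exchange_class R (g x)) ` F)"
      unfolding img' by (rule fin)
    have "exchange_class R ` F = (\<lambda>x. exchange_class R (g x)) ` F"
      unfolding img img' by (rule refl)
    from kernel_eq_if_kernel_le[OF fin_img this le ab class_ab]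
    have "exchange_class R (g a) = exchange_class R (g b)" .
    then show "exchangeable R ?E (g a) (g b)"
      by (simp only: exchange_class_eq_iff[OF E(2)[OF ab(1)]])
  qed
qed

section \<open>Orders whose coloured order types determine the relations\<close>

text \<open>
  Stated pointwise, so that it passes to subsets, depends on \<open>r\<close> only inside \<open>F\<close>, and holds as
  soon as it holds for the finite subsets of \<open>F\<close> and of \<open>J\<close>.
\<close>

definition indiscernible_order ::
    "('a, 'i) rel_struct \<Rightarrow> ('a \<Rightarrow> nat) \<Rightarrow> 'a set \<Rightarrow> 'i set \<Rightarrow> 'a rel \<Rightarrow> bool" where
  "indiscernible_order R c F J r \<longleftrightarrow>
     (\<forall>x\<in>F. \<forall>y\<in>F. (x, y) \<in> r \<or> (y, x) \<in> r) \<and>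
     (\<forall>x\<in>F. \<forall>y\<in>F. (x, y) \<in> r \<and> (y, x) \<in> r \<longrightarrow> x = y) \<and>
     (\<forall>x\<in>F. \<forall>y\<in>F. \<forall>z\<in>F. (x, y) \<in> r \<and> (y, z) \<in> r \<longrightarrow> (x, z) \<in> r) \<and>
     (\<forall>x\<in>F. \<forall>y\<in>F. \<forall>z\<in>F. c x = c z \<and> (x, y) \<in> r \<and> (y, z) \<in> r \<longrightarrow> c y = c x) \<and>
     (\<forall>i\<in>J. \<forall>xs\<in>nlists (rel_arity R i) F. \<forall>ys\<in>nlists (rel_arity R i) F.
        map c xs = map c ys \<and>
        (\<forall>j<rel_arity R i. \<forall>k<rel_arity R i. (xs ! j, xs ! k) \<in> r \<longleftrightarrow> (ys ! j, ys ! k) \<in> r) \<longrightarrow>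
        (xs \<in> rel_at R i \<longleftrightarrow> ys \<in> rel_at R i))"

lemma indiscernible_orderI:
  assumes "\<And>x y. x \<in> F \<Longrightarrow> y \<in> F \<Longrightarrow> (x, y) \<in> r \<or> (y, x) \<in> r"
    and "\<And>x y. x \<in> F \<Longrightarrow> y \<in> F \<Longrightarrow> (x, y) \<in> r \<Longrightarrow> (y, x) \<in> r \<Longrightarrow> x = y"
    and "\<And>x y z. x \<in> F \<Longrightarrow> y \<in> F \<Longrightarrow> z \<in> F \<Longrightarrow> (x, y) \<in> r \<Longrightarrow> (y, z) \<in> r \<Longrightarrow> (x, z) \<in> r"
    and "\<And>x y z. x \<in> F \<Longrightarrow> y \<in> F \<Longrightarrow> z \<in> F \<Longrightarrow> c x = c z \<Longrightarrow> (x, y) \<in> r \<Longrightarrow> (y, z) \<in> r \<Longrightarrow>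
      c y = c x"
    and "\<And>i xs ys. i \<in> J \<Longrightarrow> xs \<in> nlists (rel_arity R i) F \<Longrightarrow> ys \<in> nlists (rel_arity R i) F \<Longrightarrow>
      map c xs = map c ys \<Longrightarrow>
      (\<And>j k. j < rel_arity R i \<Longrightarrow> k < rel_arity R i \<Longrightarrow>
        (xs ! j, xs ! k) \<in> r \<longleftrightarrow> (ys ! j, ys ! k) \<in> r) \<Longrightarrow>
      xs \<in> rel_at R i \<longleftrightarrow> ys \<in> rel_at R i"
  shows "indiscernible_order R c F J r"
  unfolding indiscernible_order_def
  by (intro conjI ballI impI; (elim conjE)?)
    (use assms(1) in blast, rule assms(2), assumption+, rule assms(3), assumption+,
      rule assms(4), assumption+, rule assms(5), assumption+, simp)

lemma indiscernible_orderD: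
  assumes "indiscernible_order R c F J r"
  shows indiscernible_order_total: "x \<in> F \<Longrightarrow> y \<in> F \<Longrightarrow> (x, y) \<in> r \<or> (y, x) \<in> r"
    and indiscernible_order_antisym:
      "x \<in> F \<Longrightarrow> y \<in> F \<Longrightarrow> (x, y) \<in> r \<Longrightarrow> (y, x) \<in> r \<Longrightarrow> x = y"
    and indiscernible_order_trans:
      "x \<in> F \<Longrightarrow> y \<in> F \<Longrightarrow> z \<in> F \<Longrightarrow> (x, y) \<in> r \<Longrightarrow> (y, z) \<in> r \<Longrightarrow> (x, z) \<in> r"
    and indiscernible_order_convex:
      "x \<in> F \<Longrightarrow> y \<in> F \<Longrightarrow> z \<in> F \<Longrightarrow> c x = c z \<Longrightarrow> (x, y) \<in> r \<Longrightarrow> (y, z) \<in> r \<Longrightarrow> c y = c x"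
    and indiscernible_order_homogeneous:
      "i \<in> J \<Longrightarrow> xs \<in> nlists (rel_arity R i) F \<Longrightarrow> ys \<in> nlists (rel_arity R i) F \<Longrightarrow>
       map c xs = map c ys \<Longrightarrow>
       (\<And>j k. j < rel_arity R i \<Longrightarrow> k < rel_arity R i \<Longrightarrow>
         (xs ! j, xs ! k) \<in> r \<longleftrightarrow> (ys ! j, ys ! k) \<in> r) \<Longrightarrow>
       xs \<in> rel_at R i \<longleftrightarrow> ys \<in> rel_at R i"
proof -
  note r = assms[unfolded indiscernible_order_def]
  show "x \<in> F \<Longrightarrow> y \<in> F \<Longrightarrow> (x, y) \<in> r \<or> (y, x) \<in> r"
    by (rule r[THEN conjunct1, THEN bspec, THEN bspec])
  show "x \<in> F \<Longrightarrow> y \<in> F \<Longrightarrow> (x, y) \<in> r \<Longrightarrow> (y, x) \<in> r \<Longrightarrow> x = y"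
    by (rule r[THEN conjunct2, THEN conjunct1, THEN bspec, THEN bspec, THEN mp, OF _ _ conjI])
  show "x \<in> F \<Longrightarrow> y \<in> F \<Longrightarrow> z \<in> F \<Longrightarrow> (x, y) \<in> r \<Longrightarrow> (y, z) \<in> r \<Longrightarrow> (x, z) \<in> r"
    by (rule r[THEN conjunct2, THEN conjunct2, THEN conjunct1, THEN bspec, THEN bspec, THEN bspec,
          THEN mp, OF _ _ _ conjI])
  show "x \<in> F \<Longrightarrow> y \<in> F \<Longrightarrow> z \<in> F \<Longrightarrow> c x = c z \<Longrightarrow> (x, y) \<in> r \<Longrightarrow> (y, z) \<in> r \<Longrightarrow> c y = c x"
    by (rule r[THEN conjunct2, THEN conjunct2, THEN conjunct2, THEN conjunct1, THEN bspec, THEN bspec,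
          THEN bspec, THEN mp, OF _ _ _ conjI[OF _ conjI]])
  assume "i \<in> J" "xs \<in> nlists (rel_arity R i) F" "ys \<in> nlists (rel_arity R i) F"
    "map c xs = map c ys"
    and pat: "\<And>j k. j < rel_arity R i \<Longrightarrow> k < rel_arity R i \<Longrightarrow>
      (xs ! j, xs ! k) \<in> r \<longleftrightarrow> (ys ! j, ys ! k) \<in> r"
  then show "xs \<in> rel_at R i \<longleftrightarrow> ys \<in> rel_at R i"
    by (intro r[THEN conjunct2, THEN conjunct2, THEN conjunct2, THEN conjunct2, THEN bspec,
          THEN bspec, THEN bspec, THEN mp] conjI allI impI)
qed

lemma indiscernible_order_subset:
  assumes r: "indiscernible_order R c F J r" and "F' \<subseteq> F" "J' \<subseteq> J"
  shows "indiscernible_order R c F' J' r"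
proof -
  have F: "x \<in> F" if "x \<in> F'" for x
    using assms(2) that by (rule subsetD)
  have lists: "xs \<in> nlists n F" if "xs \<in> nlists n F'" for n xs
    using nlists_mono[OF assms(2)] that by (rule subsetD)
  have J: "i \<in> J" if "i \<in> J'" for i
    using assms(3) that by (rule subsetD)
  show ?thesis
  proof (rule indiscernible_orderI)
    fix x y assume xy: "x \<in> F'" "y \<in> F'"
    show "(x, y) \<in> r \<or> (y, x) \<in> r"
      using xy by (intro indiscernible_order_total[OF r] F)
    show "x = y" if "(x, y) \<in> r" "(y, x) \<in> r"
      by (rule indiscernible_order_antisym[OF r F F]) fact+
    fix z assume z: "z \<in> F'"
    show "(x, z) \<in> r" if "(x, y) \<in> r" "(y, z) \<in> r"
      by (rule indiscernible_order_trans[OF r F[OF xy(1)] F[OF xy(2)] F]) fact+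
    show "c y = c x" if "c x = c z" "(x, y) \<in> r" "(y, z) \<in> r"
      by (rule indiscernible_order_convex[OF r F F F]) fact+
  qed (rule indiscernible_order_homogeneous[OF r J lists lists])
qed

lemma indiscernible_order_cong:
  assumes eq: "r \<inter> F \<times> F = s \<inter> F \<times> F" and r: "indiscernible_order R c F J r"
  shows "indiscernible_order R c F J s"
proof -
  have rs: "(x, y) \<in> s \<longleftrightarrow> (x, y) \<in> r" if "x \<in> F" "y \<in> F" for x y
    using eq that by blast
  show ?thesis
  proof (rule indiscernible_orderI)
    fix x y assume xy: "x \<in> F" "y \<in> F"
    show "(x, y) \<in> s \<or> (y, x) \<in> s"
      using indiscernible_order_total[OF r xy] rs xy by simp
    show "x = y" if "(x, y) \<in> s" "(y, x) \<in> s"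
      using indiscernible_order_antisym[OF r xy] rs xy that by simp
    fix z assume z: "z \<in> F"
    show "(x, z) \<in> s" if "(x, y) \<in> s" "(y, z) \<in> s"
      using indiscernible_order_trans[OF r xy z] rs xy z that by simp
    show "c y = c x" if "c x = c z" "(x, y) \<in> s" "(y, z) \<in> s"
      using indiscernible_order_convex[OF r xy z that(1)] rs xy z that(2,3) by simp
  next
    fix i xs ys
    assume i: "i \<in> J" and xs: "xs \<in> nlists (rel_arity R i) F" and ys: "ys \<in> nlists (rel_arity R i) F"
      and col: "map c xs = map c ys"
      and pat: "\<And>j k. j < rel_arity R i \<Longrightarrow> k < rel_arity R i \<Longrightarrow>
        (xs ! j, xs ! k) \<in> s \<longleftrightarrow> (ys ! j, ys ! k) \<in> s"
    show "xs \<in> rel_at R i \<longleftrightarrow> ys \<in> rel_at R i"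
    proof (rule indiscernible_order_homogeneous[OF r i xs ys col])
      fix j k assume jk: "j < rel_arity R i" "k < rel_arity R i"
      show "(xs ! j, xs ! k) \<in> r \<longleftrightarrow> (ys ! j, ys ! k) \<in> r"
        using pat[OF jk] rs[OF nlistsE_nth_in[OF xs jk(1)] nlistsE_nth_in[OF xs jk(2)]]
          rs[OF nlistsE_nth_in[OF ys jk(1)] nlistsE_nth_in[OF ys jk(2)]] by simp
    qed
  qed
qed

lemma indiscernible_orderI_finite:
  assumes fin: "\<And>F' J'. finite F' \<Longrightarrow> F' \<subseteq> F \<Longrightarrow> finite J' \<Longrightarrow> J' \<subseteq> J \<Longrightarrow> indiscernible_order R c F' J' r"
  shows "indiscernible_order R c F J r"
proof (rule indiscernible_orderI)
  have three: "indiscernible_order R c {x, y, z} {} r" if "x \<in> F" "y \<in> F" "z \<in> F" for x y z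
    using that by (intro fin) auto
  fix x y assume mem: "x \<in> F" "y \<in> F"
  show "(x, y) \<in> r \<or> (y, x) \<in> r"
    by (rule indiscernible_order_total[OF three[OF mem mem(2)]]) simp_all
  show "x = y" if "(x, y) \<in> r" "(y, x) \<in> r"
    by (rule indiscernible_order_antisym[OF three[OF mem mem(2)] _ _ that]) simp_all
  fix z assume z: "z \<in> F"
  show "(x, z) \<in> r" if "(x, y) \<in> r" "(y, z) \<in> r"
    by (rule indiscernible_order_trans[OF three[OF mem z] _ _ _ that]) simp_all
  show "c y = c x" if "c x = c z" "(x, y) \<in> r" "(y, z) \<in> r"
    by (rule indiscernible_order_convex[OF three[OF mem z] _ _ _ that]) simp_all
next
  fix i xs ys
  assume i: "i \<in> J" and xs: "xs \<in> nlists (rel_arity R i) F" and ys: "ys \<in> nlists (rel_arity R i) F"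
    and col: "map c xs = map c ys"
    and pat: "\<And>j k. j < rel_arity R i \<Longrightarrow> k < rel_arity R i \<Longrightarrow>
      (xs ! j, xs ! k) \<in> r \<longleftrightarrow> (ys ! j, ys ! k) \<in> r"
  have "indiscernible_order R c (set xs \<union> set ys) {i} r"
    using i xs ys by (intro fin) (auto simp: nlists_def)
  moreover have "xs \<in> nlists (rel_arity R i) (set xs \<union> set ys)"
    "ys \<in> nlists (rel_arity R i) (set xs \<union> set ys)"
    using xs ys by (auto simp: nlists_def)
  ultimately show "xs \<in> rel_at R i \<longleftrightarrow> ys \<in> rel_at R i"
    using indiscernible_order_homogeneous[of R c _ "{i}" r i xs ys] col pat by simp
qed

text \<open>
  The finite set is first enlarged until it determines the minimal decomposition and until its
  traces on the infinite classes are larger than all finite classes.  Then an isomorphism onto a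
  homogeneous copy respects the colours, so the order of the copy can be pulled back along it.
  The isomorphism may permute colours; only equality of colours has to be preserved.
\<close>

lemma finite_indiscernible_order:
  assumes fin: "finite (exchange_classes R)"
    and colours: "finite (c ` base R)"
    and c: "\<And>a b. a \<in> base R \<Longrightarrow> b \<in> base R \<Longrightarrow>
      c a = c b \<longleftrightarrow> a = b \<or> exchangeable R (base R) a b \<and> infinite (exchange_class R a)"
    and F0: "finite F0" "F0 \<subseteq> base R" and J: "finite J" "J \<subseteq> rel_index R"
  shows "\<exists>r. indiscernible_order R c F0 J r"
proof -
  let ?E = "base R"
  let ?cls = "exchange_class R"
  (* Traces of size at least N distinguish the infinite classes from the finite ones. *)
  define N where "N = Suc (card (\<Union>{B \<in> exchange_classes R. finite B}))"
  have small_fin: "finite (\<Union>{B \<in> exchange_classes R. finite B})"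
    using fin by (intro finite_Union) auto
  have small: "card (?cls a) < N" if "a \<in> ?E" "finite (?cls a)" for a
  proof -
    have "?cls a \<subseteq> \<Union>{B \<in> exchange_classes R. finite B}"
      using that by (intro Union_upper) (auto simp: exchange_classes_eq_image)
    then show ?thesis
      unfolding N_def using card_mono[OF small_fin] by (simp add: le_imp_less_Suc)
  qed
  have "\<forall>B\<in>exchange_classes R. \<exists>S. finite S \<and> S \<subseteq> B \<and> (if finite B then S = B else card S = N)"
  proof
    fix B
    show "\<exists>S. finite S \<and> S \<subseteq> B \<and> (if finite B then S = B else card S = N)"
    proof (cases "finite B")
      case True
      then show ?thesis
        by (intro exI[of _ B]) simp
    next
      case False
      then show ?thesis
        using infinite_arbitrarily_large[OF False, of N] by auto
    qed
  qed
  from bchoice[OF this] obtain part where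
    part: "\<forall>B\<in>exchange_classes R. finite (part B) \<and> part B \<subseteq> B \<and>
      (if finite B then part B = B else card (part B) = N)"
    by (rule exE)
  have part_cls: "finite (part (?cls a)) \<and> part (?cls a) \<subseteq> ?cls a \<and>
      (if finite (?cls a) then part (?cls a) = ?cls a else card (part (?cls a)) = N)" if "a \<in> ?E" for a
    using bspec[OF part, of "?cls a"] that by (simp add: exchange_classes_eq_image)
  obtain W where W: "W \<subseteq> ?E" "finite W" "\<forall>a\<in>?E. W \<inter> ?cls a \<noteq> {}"
    "\<forall>F a b. W \<subseteq> F \<longrightarrow> F \<subseteq> ?E \<longrightarrow> exchangeable R F a b \<longrightarrow> exchangeable R ?E a b"
    using exchangeability_witnesses[OF fin] by (elim exE conjE) (rule that)
  define F where "F = F0 \<union> W \<union> (\<Union>B\<in>exchange_classes R. part B)"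
  have F: "finite F" "F0 \<subseteq> F" "W \<subseteq> F"
    using F0(1) W(2) fin part by (auto simp: F_def)
  have partF: "part (?cls a) \<subseteq> F" if "a \<in> ?E" for a
    using that by (auto simp: F_def exchange_classes_eq_image)
  have cls_E: "?cls a \<subseteq> ?E" for a
    by (auto simp: exchangeable_def)
  have "part B \<subseteq> ?E" if "B \<in> exchange_classes R" for B
    using bspec[OF part that] that cls_E by (auto simp: exchange_classes_eq_image)
  then have FE: "F \<subseteq> ?E"
    using F0(2) W(1) by (auto simp: F_def)
  have F_fin: "?cls a \<subseteq> F" if "a \<in> ?E" "finite (?cls a)" for a
    using partF[OF that(1)] part_cls[OF that(1)] that(2) by simp
  have F_inf: "N \<le> card (F \<inter> ?cls a)" if "a \<in> ?E" "infinite (?cls a)" for a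
  proof -
    have "part (?cls a) \<subseteq> F \<inter> ?cls a" "card (part (?cls a)) = N"
      using partF[OF that(1)] part_cls[OF that(1)] that(2) by auto
    then show ?thesis
      using card_mono[of "F \<inter> ?cls a" "part (?cls a)"] F(1) by simp
  qed
  have refl: "exchangeable R ?E a a" if "a \<in> ?E" for a
    using that by (rule exchangeable_refl)
  have inf_colour: "c x = c a \<longleftrightarrow> x \<in> ?cls a" if "a \<in> ?E" "infinite (?cls a)" "x \<in> ?E" for a x
    using c[OF that(1,3)] that(2) refl[OF that(1)] by auto
  have fibres: "\<forall>a\<in>?E. \<forall>b\<in>?E. c a = c b \<and> finite {x \<in> ?E. c x = c a} \<longrightarrow> a = b"
  proof (intro ballI impI, elim conjE, rule ccontr)
    fix a b assume ab: "a \<in> ?E" "b \<in> ?E" "c a = c b" and f: "finite {x \<in> ?E. c x = c a}"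
      and "a \<noteq> b"
    then have inf: "infinite (?cls a)"
      using c[OF ab(1,2)] ab(3) by simp
    then have "?cls a = {x \<in> ?E. c x = c a}"
      using inf_colour[OF ab(1)] cls_E[of a] by blast
    with inf f show False
      by simp
  qed
  obtain F' and pos :: "'a \<Rightarrow> nat" where F': "F' \<subseteq> ?E" "finite F'"
    and card_F': "\<forall>s. card {x \<in> F'. c x = s} = card {x \<in> F. c x = s}"
    and inj_pos: "inj_on pos F'"
    and pos_mono: "\<forall>x\<in>F'. \<forall>y\<in>F'. c x < c y \<longrightarrow> pos x < pos y"
    and hom: "\<forall>i\<in>J. \<forall>xs\<in>nlists (rel_arity R i) F'. \<forall>ys\<in>nlists (rel_arity R i) F'.
         map c xs = map c ys \<and>
         (\<forall>j<rel_arity R i. \<forall>k<rel_arity R i. pos (xs ! j) < pos (xs ! k) \<longleftrightarrow> pos (ys ! j) < pos (ys ! k)) \<longrightarrow>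
         (xs \<in> rel_at R i \<longleftrightarrow> ys \<in> rel_at R i)"
    using homogeneous_copy[of c ?E F J "rel_arity R" "rel_at R", OF colours fibres FE F(1) J(1)]
    by (elim exE conjE) (rule that)
  have F'_fin: "?cls a \<subseteq> F'" if a: "a \<in> ?E" "finite (?cls a)" for a
  proof
    fix b assume b: "b \<in> ?cls a"
    then have bF: "b \<in> F" and bE: "b \<in> ?E"
      using F_fin[OF a] cls_E by auto
    have "card {x \<in> F. c x = c b} \<noteq> 0"
      using bF F(1) by auto
    then have "{x \<in> F'. c x = c b} \<noteq> {}"
      using card_F' by (metis card.empty)
    then obtain x where x: "x \<in> F'" "c x = c b"
      by auto
    have "?cls b = ?cls a"
      using b exchange_class_eq_iff[OF a(1), of b] by blast
    then have "b = x"
      using c[OF bE subsetD[OF F'(1) x(1)]] x(2) a(2) by simp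
    then show "b \<in> F'"
      using x(1) by simp
  qed
  have counts: "card (F \<inter> ?cls a) = card (F' \<inter> ?cls a)" if a: "a \<in> ?E" for a
  proof (cases "finite (?cls a)")
    case True
    then have "F \<inter> ?cls a = ?cls a" "F' \<inter> ?cls a = ?cls a"
      using F_fin[OF a] F'_fin[OF a] by auto
    then show ?thesis
      by (simp only:)
  next
    case False
    have "F \<inter> ?cls a = {x \<in> F. c x = c a}" "F' \<inter> ?cls a = {x \<in> F'. c x = c a}"
      using inf_colour[OF a False] FE F'(1) by auto
    then show ?thesis
      using card_F' by (simp only:)
  qed
  have "monomorphic_decomposition R (exchange_classes R)"
    using is_minimal_exchange_classes[of R] unfolding is_minimal_monomorphic_decomposition_def
    by (rule conjunct1)
  moreover have "\<forall>B\<in>exchange_classes R. card (F \<inter> B) = card (F' \<inter> B)"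
    using counts by (simp add: exchange_classes_eq_image)
  ultimately have "isomorphic_restrictions R F F'"
    using F(1) FE F' by (simp add: monomorphic_decomposition_def)
  then obtain g where g: "rel_isomorphism g (restriction R F) (restriction R F')"
    unfolding rel_isomorphic_def by (rule exE)
  then have bij: "bij_betw g F F'"
    by (simp add: rel_isomorphism_restriction_iff)
  have gF: "g x \<in> F'" if "x \<in> F" for x
    using bij that by (rule bij_betwE[THEN bspec])
  have E: "x \<in> ?E" "g x \<in> ?E" if "x \<in> F" for x
    using that gF FE F'(1) by auto
  have ex: "exchangeable R ?E (g a) (g b) \<longleftrightarrow> exchangeable R ?E a b" if "a \<in> F" "b \<in> F" for a b
  proof (rule isomorphism_preserves_exchangeability[OF fin FE F'(1) g _ _ _ that])
    show "exchangeable R ?E a b" if "exchangeable R F a b" for a b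
      using W(4) F(3) FE that by blast
    show meet: "F \<inter> ?cls a \<noteq> {}" if "a \<in> ?E" for a
      using bspec[OF W(3) that] F(3) by blast
    show "F' \<inter> ?cls a \<noteq> {}" if a: "a \<in> ?E" for a
    proof
      assume "F' \<inter> ?cls a = {}"
      then have "card (F \<inter> ?cls a) = 0"
        using counts[OF a] by (simp only: card.empty)
      then show False
        using meet[OF a] F(1) by (simp add: card_eq_0_iff)
    qed
  qed
  (* By their sizes, g cannot map the trace of an infinite class onto that of a finite class. *)
  have fin_iff: "finite (?cls (g a)) \<longleftrightarrow> finite (?cls a)" if a: "a \<in> F" for a
  proof -
    have "bij_betw g (F \<inter> ?cls a) (F' \<inter> ?cls (g a))"
      unfolding bij_betw_def
    proof
      show "inj_on g (F \<inter> ?cls a)"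
        using bij_betw_imp_inj_on[OF bij] by (rule inj_on_subset) simp
      show "g ` (F \<inter> ?cls a) = F' \<inter> ?cls (g a)"
        using ex[OF a] bij_betw_imp_surj_on[OF bij] by auto
    qed
    then have card_eq: "card (F \<inter> ?cls a) = card (F \<inter> ?cls (g a))"
      using bij_betw_same_card counts[OF E(2)[OF a]] by fastforce
    have low: "card (F \<inter> ?cls b) < N" if "b \<in> ?E" "finite (?cls b)" for b
      using card_mono[OF that(2), of "F \<inter> ?cls b"] small[OF that] by simp
    show ?thesis
      using low[of a] low[of "g a"] F_inf[of a] F_inf[of "g a"] E[OF a] card_eq by linarith
  qed
  have col: "c (g a) = c (g b) \<longleftrightarrow> c a = c b" if "a \<in> F" "b \<in> F" for a b
  proof -
    have "g a = g b \<longleftrightarrow> a = b"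
      using bij_betw_imp_inj_on[OF bij] that by (rule inj_on_eq_iff)
    then show ?thesis
      using c[OF E(2)[OF that(1)] E(2)[OF that(2)]] c[OF E(1)[OF that(1)] E(1)[OF that(2)]]
        ex[OF that] fin_iff[OF that(1)] by simp
  qed
  define r where "r = {(x, y). pos (g x) \<le> pos (g y)}"
  have "indiscernible_order R c F J r"
  proof (rule indiscernible_orderI)
    fix x y assume xy: "x \<in> F" "y \<in> F"
    show "(x, y) \<in> r \<or> (y, x) \<in> r"
      by (auto simp: r_def)
    show "x = y" if "(x, y) \<in> r" "(y, x) \<in> r"
    proof -
      have "pos (g x) = pos (g y)"
        using that by (simp add: r_def)
      then have "g x = g y"
        using inj_pos gF xy by (simp add: inj_on_eq_iff)
      then show ?thesis
        using bij_betw_imp_inj_on[OF bij] xy by (simp add: inj_on_eq_iff)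
    qed
    fix z assume z: "z \<in> F"
    show "(x, z) \<in> r" if "(x, y) \<in> r" "(y, z) \<in> r"
      using that by (simp add: r_def)
    show "c y = c x" if xz: "c x = c z" and le: "(x, y) \<in> r" "(y, z) \<in> r"
    proof -
      have "\<not> c (g y) < c (g x)"
        using bspec[OF bspec[OF pos_mono gF[OF xy(2)]] gF[OF xy(1)]] le(1) by (simp add: r_def)
      moreover have "\<not> c (g z) < c (g y)"
        using bspec[OF bspec[OF pos_mono gF[OF z]] gF[OF xy(2)]] le(2) by (simp add: r_def)
      moreover have "c (g x) = c (g z)"
        using col[OF xy(1) z] xz by simp
      ultimately have "c (g y) = c (g x)"
        by linarith
      then show ?thesis
        using col[OF xy(2,1)] by simp
    qed
  next
    fix i xs ys
    assume i: "i \<in> J" and xs: "xs \<in> nlists (rel_arity R i) F" and ys: "ys \<in> nlists (rel_arity R i) F"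
      and c_eq: "map c xs = map c ys"
      and pat: "\<And>j k. j < rel_arity R i \<Longrightarrow> k < rel_arity R i \<Longrightarrow>
        (xs ! j, xs ! k) \<in> r \<longleftrightarrow> (ys ! j, ys ! k) \<in> r"
    have len: "length xs = rel_arity R i" "length ys = rel_arity R i"
      using xs ys by (simp_all add: nlists_def)
    have image: "map g zs \<in> nlists (rel_arity R i) F'" if "zs \<in> nlists (rel_arity R i) F" for zs
      using that gF by (auto simp: nlists_def)
    have "i \<in> rel_index R"
      using i J(2) by (rule rev_subsetD)
    then have iso: "zs \<in> rel_at R i \<longleftrightarrow> map g zs \<in> rel_at R i" if "zs \<in> nlists (rel_arity R i) F" for zs
      using g that unfolding rel_isomorphism_restriction_iff by blast
    have "map c (map g xs) = map c (map g ys)"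
    proof (rule nth_equalityI)
      fix j assume "j < length (map c (map g xs))"
      then have j: "j < rel_arity R i"
        using len by simp
      then have "c (xs ! j) = c (ys ! j)"
        using arg_cong[OF c_eq, of "\<lambda>zs. zs ! j"] len by simp
      then show "map c (map g xs) ! j = map c (map g ys) ! j"
        using col[OF nlistsE_nth_in[OF xs j] nlistsE_nth_in[OF ys j]] j len by simp
    qed (simp add: len)
    moreover have "pos (map g xs ! j) < pos (map g xs ! k) \<longleftrightarrow> pos (map g ys ! j) < pos (map g ys ! k)"
      if "j < rel_arity R i" "k < rel_arity R i" for j k
    proof -
      have "pos (g (xs ! k)) \<le> pos (g (xs ! j)) \<longleftrightarrow> pos (g (ys ! k)) \<le> pos (g (ys ! j))"
        using pat[OF that(2,1)] by (simp add: r_def)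
      then show ?thesis
        using that len by (simp add: linorder_not_le[symmetric])
    qed
    ultimately have "map g xs \<in> rel_at R i \<longleftrightarrow> map g ys \<in> rel_at R i"
      by (intro mp[OF bspec[OF bspec[OF bspec[OF hom i] image[OF xs]] image[OF ys]]] conjI allI impI)
    then show "xs \<in> rel_at R i \<longleftrightarrow> ys \<in> rel_at R i"
      using iso[OF xs] iso[OF ys] by simp
  qed
  then have "indiscernible_order R c F0 J r"
    using F(2) by (rule indiscernible_order_subset) simp
  then show ?thesis
    by (rule exI)
qed

text \<open>
  The finite parts to be satisfied simultaneously are directed: finitely many pairs \<open>(F, J)\<close> lie
  below the pair of their unions.
\<close>

lemma indiscernible_order_exists:
  assumes fin: "finite (exchange_classes R)"
    and colours: "finite (c ` base R)"
    and c: "\<And>a b. a \<in> base R \<Longrightarrow> b \<in> base R \<Longrightarrow>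
      c a = c b \<longleftrightarrow> a = b \<or> exchangeable R (base R) a b \<and> infinite (exchange_class R a)"
  shows "\<exists>r. indiscernible_order R c (base R) (rel_index R) r"
proof -
  define K where "K = {(F, J). finite F \<and> F \<subseteq> base R \<and> finite J \<and> J \<subseteq> rel_index R}"
  have "\<exists>r. \<forall>k\<in>K. indiscernible_order R c (fst k) (snd k) r"
  proof (rule finite_support_compactness)
    show "\<exists>D. finite D \<and> (\<forall>r s. r \<inter> D = s \<inter> D \<longrightarrow>
        indiscernible_order R c (fst k) (snd k) r \<longrightarrow> indiscernible_order R c (fst k) (snd k) s)"
      if "k \<in> K" for k
    proof (intro exI[of _ "fst k \<times> fst k"] conjI allI impI)
      show "finite (fst k \<times> fst k)"
        using that by (auto simp: K_def)
    qed (rule indiscernible_order_cong)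
    fix K' assume K': "finite K'" "K' \<subseteq> K"
    let ?F = "\<Union>(fst ` K')" and ?J = "\<Union>(snd ` K')"
    have k: "finite (fst k) \<and> fst k \<subseteq> base R \<and> finite (snd k) \<and> snd k \<subseteq> rel_index R" if "k \<in> K'" for k
      using subsetD[OF K'(2) that] by (auto simp: K_def)
    then have "finite ?F" "finite ?J"
      using K'(1) by simp_all
    moreover have "?F \<subseteq> base R" "?J \<subseteq> rel_index R"
      using k by (simp_all add: UN_subset_iff)
    ultimately have "\<exists>r. indiscernible_order R c ?F ?J r"
      by (intro finite_indiscernible_order[OF fin colours]) (rule c)
    then obtain r where r: "indiscernible_order R c ?F ?J r"
      by (rule exE)
    have "indiscernible_order R c (fst k) (snd k) r" if "k \<in> K'" for k
      using r that by (intro indiscernible_order_subset[OF r]) auto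
    then show "\<exists>r. \<forall>k\<in>K'. indiscernible_order R c (fst k) (snd k) r"
      by blast
  qed
  then obtain r where r: "\<forall>k\<in>K. indiscernible_order R c (fst k) (snd k) r"
    by (rule exE)
  have "indiscernible_order R c (base R) (rel_index R) r"
  proof (rule indiscernible_orderI_finite)
    fix F J assume "finite F" "F \<subseteq> base R" "finite J" "J \<subseteq> rel_index R"
    then have "(F, J) \<in> K"
      by (simp add: K_def)
    then show "indiscernible_order R c F J r"
      using r by fastforce
  qed
  then show ?thesis
    by (rule exI)
qed

section \<open>The interval decomposition\<close>

lemma colouring_of_finite_partition:
  assumes part: "partition_on E P" and "finite P"
  shows "\<exists>c :: 'a \<Rightarrow> nat. finite (c ` E) \<and>
    (\<forall>B\<in>P. \<forall>x\<in>B. \<forall>y\<in>E. c x = c y \<longleftrightarrow> y \<in> B)"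
proof -
  obtain h :: "'a set \<Rightarrow> nat" where h: "inj_on h P"
    using finite_imp_inj_to_nat_seg[OF \<open>finite P\<close>] by blast
  define c where "c x = h (THE B. B \<in> P \<and> x \<in> B)" for x
  have c: "c x = h B" if "B \<in> P" "x \<in> B" for x B
  proof -
    have "(THE B. B \<in> P \<and> x \<in> B) = B"
      using that partition_on_block_unique[OF part] by (intro the_equality) auto
    then show ?thesis
      by (simp add: c_def)
  qed
  have "c x = c y \<longleftrightarrow> y \<in> B" if xB: "B \<in> P" "x \<in> B" and y: "y \<in> E" for B x y
  proof -
    obtain C where C: "C \<in> P" "y \<in> C"
      using partition_on_block_ex[OF part y] by (elim bexE) (rule that)
    have "c x = c y \<longleftrightarrow> B = C"
      using c[OF xB] c[OF C] inj_on_eq_iff[OF h xB(1) C(1)] by simp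
    also have "\<dots> \<longleftrightarrow> y \<in> B"
      using C xB(1) partition_on_block_unique[OF part] by metis
    finally show ?thesis .
  qed
  moreover have "finite (c ` E)"
  proof (rule finite_subset)
    show "c ` E \<subseteq> h ` P"
    proof
      fix s assume "s \<in> c ` E"
      then obtain x where x: "x \<in> E" "s = c x"
        by (elim imageE)
      obtain B where "B \<in> P" "x \<in> B"
        using partition_on_block_ex[OF part x(1)] by (elim bexE)
      then show "s \<in> h ` P"
        using c x(2) by simp
    qed
  qed (simp add: \<open>finite P\<close>)
  ultimately show ?thesis
    by (intro exI[of _ c]) simp
qed

lemma finite_interval_decompositionI_indiscernible:
  assumes part: "partition_on (base R) P" and "finite P"
    and c: "\<forall>B\<in>P. \<forall>x\<in>B. \<forall>y\<in>base R. c x = c y \<longleftrightarrow> y \<in> B"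
    and r: "indiscernible_order R c (base R) (rel_index R) r"
  shows "finite_interval_decomposition R (r \<inter> base R \<times> base R) P"
proof -
  let ?E = "base R"
  let ?r = "r \<inter> ?E \<times> ?E"
  note total = indiscernible_order_total[OF r] and anti = indiscernible_order_antisym[OF r]
    and tr = indiscernible_order_trans[OF r] and conv = indiscernible_order_convex[OF r]
  have BE: "B \<subseteq> ?E" if "B \<in> P" for B
    using that partition_onD1[OF part] by auto
  have "linear_order_on ?E ?r"
    unfolding order_on_defs
  proof (intro conjI)
    show "?r \<subseteq> ?E \<times> ?E"
      by simp
    show "refl_on ?E ?r"
      using total by (auto simp: refl_on_def)
    show "trans ?r"
      using tr by (intro transI) auto
    show "antisym ?r"
      using anti by (intro antisymI) auto
    show "total_on ?E ?r"
      using total by (auto simp: total_on_def)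
  qed
  moreover have "order_interval ?E ?r B" if B: "B \<in> P" for B
    unfolding order_interval_def
  proof (intro conjI ballI impI)
    show "B \<subseteq> ?E"
      by (rule BE[OF B])
    fix x z y assume x: "x \<in> B" and z: "z \<in> B" and y: "y \<in> ?E" "(x, y) \<in> ?r \<and> (y, z) \<in> ?r"
    have mem: "x \<in> ?E" "z \<in> ?E"
      using BE[OF B] x z by auto
    have "c x = c z"
      using c B x z mem by simp
    then have "c x = c y"
      using conv[OF mem(1) y(1) mem(2)] y(2) by simp
    then show "y \<in> B"
      using c B x y(1) by simp
  qed
  moreover have "local_isomorphism R f A A'"
    if f: "local_isomorphism (order_struct ?E ?r) f A A'" and pres: "\<forall>B\<in>P. preserves f A B" for f A A'
  proof -
    have A: "A \<subseteq> ?E" "A' \<subseteq> ?E" "bij_betw f A A'"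
      and ord: "\<forall>x\<in>A. \<forall>y\<in>A. (x, y) \<in> ?r \<longleftrightarrow> (f x, f y) \<in> ?r"
      using f by (simp_all add: local_isomorphism_order_struct_iff)
    have fE: "f x \<in> ?E" if "x \<in> A" for x
      using bij_betwE[OF A(3)] A(2) that by blast
    have ord_r: "(x, y) \<in> r \<longleftrightarrow> (f x, f y) \<in> r" if "x \<in> A" "y \<in> A" for x y
      using ord that fE A(1) by auto
    have colour: "c (f x) = c x" if x: "x \<in> A" for x
    proof -
      obtain B where B: "B \<in> P" "x \<in> B"
        using partition_on_block_ex[OF part] A(1) x by blast
      then have "f x \<in> B"
        using pres x unfolding preserves_def by blast
      then show ?thesis
        using bspec[OF bspec[OF bspec[OF c B(1)] B(2)] fE[OF x]] by simp
    qed
    have "xs \<in> rel_at R i \<longleftrightarrow> map f xs \<in> rel_at R i"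
      if i: "i \<in> rel_index R" and xs: "xs \<in> nlists (rel_arity R i) A" for i xs
    proof -
      have x: "xs ! j \<in> A" if "j < rel_arity R i" for j
        using xs that by (rule nlistsE_nth_in)
      have len: "length xs = rel_arity R i" and "set xs \<subseteq> A"
        using xs by (simp_all add: nlists_def)
      show ?thesis
      proof (rule indiscernible_order_homogeneous[OF r i])
        show "xs \<in> nlists (rel_arity R i) ?E" "map f xs \<in> nlists (rel_arity R i) ?E"
          using xs A(1) fE by (auto simp: nlists_def)
        show "map c xs = map c (map f xs)"
          using colour \<open>set xs \<subseteq> A\<close> by auto
        show "(xs ! j, xs ! k) \<in> r \<longleftrightarrow> (map f xs ! j, map f xs ! k) \<in> r"
          if "j < rel_arity R i" "k < rel_arity R i" for j k
          using ord_r[OF x[OF that(1)] x[OF that(2)]] that len by simp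
      qed
    qed
    then show ?thesis
      using A by (simp add: local_isomorphism_def rel_isomorphism_restriction_iff)
  qed
  ultimately show ?thesis
    using part \<open>finite P\<close> by (simp add: finite_interval_decomposition_def)
qed

text \<open>
  Each infinite class of exchangeable elements is an interval of the order.  The finite classes
  are cut into singletons, which leaves the infinite blocks of the minimal decomposition.
\<close>

lemma monomorphic_imp_finite_interval_decomposition:
  assumes fin: "finite (exchange_classes R)"
  shows "\<exists>r P. finite_interval_decomposition R r P \<and>
    {B \<in> P. infinite B} = {B \<in> exchange_classes R. infinite B}"
proof -
  let ?E = "base R"
  let ?X = "{B \<in> exchange_classes R. infinite B}"
  let ?S = "\<Union>{B \<in> exchange_classes R. finite B}"
  define P where "P = ?X \<union> (\<lambda>a. {a}) ` ?S"
  have cls: "partition_on ?E (exchange_classes R)"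
    unfolding exchange_classes_def by (rule partition_on_quotient[OF equiv_exchangeable])
  note unique = partition_on_block_unique[OF cls]
  have part: "partition_on ?E P"
  proof (rule partition_onI)
    show "\<Union>P = ?E"
      unfolding partition_onD1[OF cls] P_def by auto
    show "{} \<notin> P"
      by (auto simp: P_def)
    fix B C assume BC: "B \<in> P" "C \<in> P" "B \<noteq> C"
    show "disjnt B C"
      using BC unique unfolding P_def disjnt_iff by blast
  qed
  have finP: "finite P"
    unfolding P_def using fin by (intro finite_UnI finite_imageI finite_Union) auto
  obtain c :: "'a \<Rightarrow> nat" where c: "finite (c ` ?E)"
    "\<forall>B\<in>P. \<forall>x\<in>B. \<forall>y\<in>?E. c x = c y \<longleftrightarrow> y \<in> B"
    using colouring_of_finite_partition[OF part finP] by (elim exE conjE) (rule that)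
  have spec: "c a = c b \<longleftrightarrow> a = b \<or> exchangeable R ?E a b \<and> infinite (exchange_class R a)"
    if a: "a \<in> ?E" and b: "b \<in> ?E" for a b
  proof (cases "finite (exchange_class R a)")
    case True
    then have "{a} \<in> P"
      using a exchangeable_refl[OF a] by (auto simp: P_def exchange_classes_eq_image)
    then show ?thesis
      using c(2) b True by auto
  next
    case False
    then have mem: "exchange_class R a \<in> P" "a \<in> exchange_class R a"
      using a exchangeable_refl[OF a] by (auto simp: P_def exchange_classes_eq_image)
    have "c a = c b \<longleftrightarrow> b \<in> exchange_class R a"
      by (rule bspec[OF bspec[OF bspec[OF c(2) mem(1)] mem(2)] b])
    then show ?thesis
      using False exchangeable_refl[OF a] by auto
  qed
  have "\<exists>r. indiscernible_order R c ?E (rel_index R) r"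
    by (rule indiscernible_order_exists[OF fin c(1)]) (rule spec)
  then obtain r where "indiscernible_order R c ?E (rel_index R) r"
    by (rule exE)
  then have "finite_interval_decomposition R (r \<inter> ?E \<times> ?E) P"
    by (rule finite_interval_decompositionI_indiscernible[OF part finP c(2)])
  moreover have "{B \<in> P. infinite B} = ?X"
    by (auto simp: P_def)
  ultimately show ?thesis
    by blast
qed

theorem theorem1p8:
  fixes R :: "('a, 'i) rel_struct"
  assumes "relational_structure R"
  shows "((\<exists>P. monomorphic_decomposition R P \<and> finite P) \<longleftrightarrow>
            (\<exists>r P. finite_interval_decomposition R r P)) \<and>
         ((\<exists>P. monomorphic_decomposition R P \<and> finite P) \<longrightarrow>
            (\<exists>r P. finite_interval_decomposition R r P \<and>
                   num_infinite_blocks P = monomorphic_dimension R))"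
proof -
  have dim: "\<exists>r P. finite_interval_decomposition R r P \<and>
      num_infinite_blocks P = monomorphic_dimension R"
    if mono: "\<exists>P. monomorphic_decomposition R P \<and> finite P"
  proof -
    have fin: "finite (exchange_classes R)"
      using mono finite_exchange_classes by (elim exE conjE)
    obtain r P where rP: "finite_interval_decomposition R r P"
      "{B \<in> P. infinite B} = {B \<in> exchange_classes R. infinite B}"
      using monomorphic_imp_finite_interval_decomposition[OF fin] by (elim exE conjE) (rule that)
    have "num_infinite_blocks P = monomorphic_dimension R"
      unfolding monomorphic_dimension_def minimal_monomorphic_decomposition_eq
        num_infinite_blocks_def rP(2) by (rule refl)
    with rP(1) show ?thesis
      by (intro exI conjI)
  qed
  have "\<exists>P. monomorphic_decomposition R P \<and> finite P"
    if interval: "\<exists>r P. finite_interval_decomposition R r P"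
  proof -
    obtain r P where D: "finite_interval_decomposition R r P"
      using interval by (elim exE)
    then have "finite P"
      by (simp add: finite_interval_decomposition_def)
    with finite_interval_decomposition_imp_monomorphic[OF D] show ?thesis
      by (intro exI conjI)
  qed
  with dim show ?thesis
    by blast
qed

end
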